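(* Let $\mathcal{Q}$ be the space of quadrilaterals modulo similarity, regarded as a subset of $\mathbb{R}^4$ via the parameterization in the context. There is an open set in $\mathcal{Q}$ containing the rectangle line $\{(a,b,c,d)\in\mathcal{Q}: a=c,\ b=d,\ a+b=\pi/2\}$ that is contained in the union of finitely many orbit tiles.
   Context: Parameterization: a quadrilateral is cut by a diagonal into two triangles. The four angles $(a,b,c,d)$ that the diagonal makes with the four sides (the angles of the two triangles at the endpoints of the diagonal) determine the quadrilateral up to similarity, and $\mathcal{Q}$ carries the subspace topology from $\mathbb{R}^4$. Rectangles correspond exactly to the rectangle line above. A billiard path in a polygon is a straight-line trajectory inside the polygon that reflects off the sides with angle of incidence equal to angle of reflection. Trajectories hitting vertices are excluded. It is periodic if it repeats itself. The sides of a quadrilateral are labelled $0,1,2,3$. The orbit type of a periodic billiard path is the word recording the labels of the sides hit during one period. If this word has odd length, the orbit type is its square. For a word $W$, the orbit tile $O(W)$ is the set of quadrilaterals in $\mathcal{Q}$ having a periodic billiard path of orbit type $W$. *)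

theory Defs
  imports "HOL-Analysis.Analysis"
begin

text \<open>A point of R^4 encoding a quadrilateral: (a,b,c,d).  The diagonal is AC with
  A = 0, C = 1 in the complex plane; triangle ABC lies above the diagonal with angle a at A
  and angle b at C; triangle ACD lies below with angle c at C and angle d at A.
  Vertices in cyclic order A,B,C,D; side i joins vertex i to vertex (i+1) mod 4,
  so side 0 = AB, 1 = BC, 2 = CD, 3 = DA.\<close>

type_synonym quadparam = "real \<times> real \<times> real \<times> real"

definition quad_space :: "quadparam set" where
  "quad_space = {(a,b,c,d). 0 < a \<and> 0 < b \<and> 0 < c \<and> 0 < d \<and> a + b < pi \<and> c + d < pi
                     \<and> a + d \<noteq> pi \<and> b + c \<noteq> pi}"

definition rectangle_line :: "quadparam set" where
  "rectangle_line = {(a,b,c,d). (a,b,c,d) \<in> quad_space \<and> a = c \<and> b = d \<and> a + b = pi / 2}"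

fun quad_vertex :: "quadparam \<Rightarrow> nat \<Rightarrow> complex" where
  "quad_vertex (a,b,c,d) i =
     (if i = 0 then 0
      else if i = 1 then complex_of_real (sin b / sin (a + b)) * cis a
      else if i = 2 then 1
      else complex_of_real (sin c / sin (c + d)) * cis (- d))"

definition quad_region :: "quadparam \<Rightarrow> complex set" where
  "quad_region q = convex hull {quad_vertex q 0, quad_vertex q 1, quad_vertex q 2}
                 \<union> convex hull {quad_vertex q 0, quad_vertex q 2, quad_vertex q 3}"

definition side_start :: "quadparam \<Rightarrow> nat \<Rightarrow> complex" where
  "side_start q i = quad_vertex q i"

definition side_end :: "quadparam \<Rightarrow> nat \<Rightarrow> complex" where
  "side_end q i = quad_vertex q (Suc i mod 4)"

definition reflect_dir :: "complex \<Rightarrow> complex \<Rightarrow> complex" where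
  "reflect_dir u v = (u / cnj u) * cnj v"

text \<open>A billiard path: p k is the k-th bounce point, lying in the relative interior of
  side s k (so not at a vertex); the chord between consecutive bounce points is
  nondegenerate and lies (apart from its endpoints) in the interior of the quadrilateral
  (so it neither hits a vertex nor touches the boundary in between);
  and the angle of incidence equals the angle of reflection at every bounce.\<close>
definition billiard_path :: "quadparam \<Rightarrow> (nat \<Rightarrow> complex) \<Rightarrow> (nat \<Rightarrow> nat) \<Rightarrow> bool" where
  "billiard_path q p s \<longleftrightarrow>
     (\<forall>k. s k < 4
        \<and> p k \<in> open_segment (side_start q (s k)) (side_end q (s k))
        \<and> p (Suc k) \<noteq> p k
        \<and> open_segment (p k) (p (Suc k)) \<subseteq> interior (quad_region q)
        \<and> (\<exists>l>0. p (Suc (Suc k)) - p (Suc k) =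
                  complex_of_real l *
                  reflect_dir (side_end q (s (Suc k)) - side_start q (s (Suc k)))
                              (p (Suc k) - p k)))"

definition orbit_type_of_word :: "nat list \<Rightarrow> nat list" where
  "orbit_type_of_word V = (if odd (length V) then V @ V else V)"

definition has_periodic_path_of_type :: "quadparam \<Rightarrow> nat list \<Rightarrow> bool" where
  "has_periodic_path_of_type q W \<longleftrightarrow>
     (\<exists>p s n. billiard_path q p s \<and> 0 < n \<and> (\<forall>k. p (k + n) = p k)
        \<and> (\<forall>m. 0 < m \<and> m < n \<longrightarrow> \<not> (\<forall>k. p (k + m) = p k))
        \<and> W = orbit_type_of_word (map s [0..<n]))"

definition orbit_tile :: "nat list \<Rightarrow> quadparam set" where
  "orbit_tile W = {q \<in> quad_space. has_periodic_path_of_type q W}"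

end

theory Submission
  imports Defs
begin

text \<open>
  Write the four angles as \<open>pi/2 + e\<^sub>i\<close>, so that the \<open>e\<^sub>i\<close> sum to 0. Consider a path that stays close
  to a diagonal joining two vertices, and whose signed distance \<open>q\<close> from the vertices it passes is small.
  At a vertex it hits both adjacent sides, one after the other. These two reflections compose to a rotation about
  the vertex by \<open>pi + 2 e\<close> in one sense or the other, depending on the side on which the vertex is passed.
  So the vertex kicks the direction of the path by \<open>2 e\<close>, towards the diagonal for an acute angle and away from
  it for an obtuse one, and \<open>q\<close> is preserved.
  After unfolding along a side, a path close to that side obeys the same recursion
  \<open>q' = q + sin \<phi>\<close>, \<open>\<phi>' = \<phi> + 2 sgn(q') e\<close>, where a change of sign of \<open>q\<close> is a bounce off that side.

  This recursion has short closed orbits if both angles are acute, or if one has defect \<open>-x < 0\<close> and the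
  other has \<open>e\<close> in \<open>[0, x/3]\<close>. Unless the quadrilateral is a rectangle (where a path bounces between two opposite
  sides), some pair of vertices is of this kind: if only one angle is acute, the other three \<open>e\<^sub>i\<close> are
  nonnegative with sum \<open>x\<close>. Hence all quadrilaterals near rectangles have periodic paths of period at most 32,
  and there are only finitely many words of bounded length.
\<close>

section \<open>Closed orbits of the kick recursion\<close>

text \<open>A state \<open>(c, q, \<phi>)\<close> sits at the vertex with defect \<open>x\<close> if \<open>c\<close> holds, otherwise at the one with
  defect \<open>y\<close>; lengths are measured in units of the distance of the two vertices.\<close>

definition kick_step :: "real \<Rightarrow> real \<Rightarrow> real \<Rightarrow> (bool \<times> real \<times> real) rel" where
  "kick_step x y b = {((c, q, \<phi>), (c', q', \<phi>')). c' = (\<not> c) \<and> q \<noteq> 0 \<and> q' \<noteq> 0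
     \<and> \<bar>q\<bar> \<le> b \<and> \<bar>q'\<bar> \<le> b \<and> \<bar>\<phi>\<bar> \<le> b \<and> \<bar>\<phi>'\<bar> \<le> b
     \<and> q' = q + sin \<phi> \<and> \<phi>' = \<phi> + 2 * sgn q' * (if c then y else x)}"

text \<open>Both bounds are for later: \<open>n \<le> 16\<close> leaves only finitely many orbit
  words, and \<open>b\<close> keeps the path so close to the axis that every bounce lands on the
  intended side.\<close>

definition kick_cycle :: "real \<Rightarrow> real \<Rightarrow> real \<Rightarrow> bool" where
  "kick_cycle x y b \<longleftrightarrow> (\<exists>S n. 0 < n \<and> n \<le> 16 \<and> (S, S) \<in> kick_step x y b ^^ n)"

lemma kick_stepI:
  assumes "q \<noteq> 0" "s = 1 \<or> s = -1" "0 < s * q'" "\<bar>q\<bar> \<le> b" "\<bar>q'\<bar> \<le> b" "\<bar>\<phi>\<bar> \<le> b" "\<bar>\<phi>'\<bar> \<le> b"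
    "sin \<phi> = q' - q" "\<phi>' = \<phi> + 2 * s * (if c then y else x)" "c' = (\<not> c)"
  shows "((c, q, \<phi>), (c', q', \<phi>')) \<in> kick_step x y b"
  using assms by (auto simp: kick_step_def)

lemma kick_stepD:
  assumes "((c, q, \<phi>), (c', q', \<phi>')) \<in> kick_step x y b"
  shows "q \<noteq> 0" "q' \<noteq> 0" "\<bar>q\<bar> \<le> b" "\<bar>q'\<bar> \<le> b" "\<bar>\<phi>\<bar> \<le> b" "\<bar>\<phi>'\<bar> \<le> b"
    "q' = q + sin \<phi>" "\<phi>' = \<phi> + 2 * sgn q' * (if c then y else x)" "c' = (\<not> c)"
  using assms unfolding kick_step_def by auto

lemma kick_cycleI:
  assumes "(S, S) \<in> kick_step x y b ^^ n" "0 < n" "n \<le> 16"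
  shows "kick_cycle x y b"
  using assms unfolding kick_cycle_def by blast

lemma relpow_map:
  assumes "(a, b) \<in> R ^^ n" "\<And>x y. (x, y) \<in> R \<Longrightarrow> (g x, g y) \<in> S"
  shows "(g a, g b) \<in> S ^^ n"
  using assms(1) by (induction n arbitrary: b) (auto intro: assms(2))

lemma kick_cycle_commute: "kick_cycle x y b \<Longrightarrow> kick_cycle y x b"
proof -
  assume "kick_cycle x y b"
  then obtain S n where n: "0 < n" "n \<le> 16" "(S, S) \<in> kick_step x y b ^^ n"
    unfolding kick_cycle_def by blast
  have "((\<lambda>(c, p). (\<not> c, p)) S, (\<lambda>(c, p). (\<not> c, p)) S) \<in> kick_step y x b ^^ n"
    by (rule relpow_map[OF n(3)]) (auto simp: kick_step_def)
  then show ?thesis using n unfolding kick_cycle_def by blast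
qed

text \<open>Up to sign the positions are \<open>sin x * cos y\<close> at the first vertex and
  \<open>cos x * sin y\<close> at the second. By the addition formulas their differences are exactly
  the sines of the angles \<open>x + y\<close> and \<open>x - y\<close>, up to sign, so the orbit
  closes without any linearisation.\<close>

lemma kick_cycle_acute_acute:
  assumes "0 < x" "x \<le> b / 20" "0 < y" "y \<le> b / 20" "b \<le> 1"
  shows "kick_cycle (- x) (- y) b"
proof -
  have x: "x < pi / 2" "y < pi / 2" using assms pi_gt3 by linarith+
  have pos: "0 < sin x" "0 < cos x" "0 < sin y" "0 < cos y"
    using assms(1,3) x by (auto intro!: sin_gt_zero cos_gt_zero)
  have sx: "sin x \<le> b / 20" "sin y \<le> b / 20"
    using assms sin_x_le_x[of x] sin_x_le_x[of y] by linarith+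
  have p: "0 < cos x * sin y" "0 < sin x * cos y" using pos by simp_all
  have l: "cos x * sin y \<le> sin y" "sin x * cos y \<le> sin x"
    using pos by (simp_all add: mult_left_le mult_left_le_one_le)
  have k1: "cos x * sin y \<le> b / 20" "sin x * cos y \<le> b / 20" using l sx by linarith+
  have v: "sin (- x - y) = - (sin x * cos y) - cos x * sin y" "sin (x - y) = sin x * cos y - cos x * sin y"
    "sin (x + y) = sin x * cos y + cos x * sin y" "sin (y - x) = cos x * sin y - sin x * cos y"
    using sin_add[of "- x" "- y"] by (simp_all add: sin_add sin_diff)
  let ?R = "kick_step (- x) (- y) b"
  have 1: "((False, cos x * sin y, - x - y), (True, - (sin x * cos y), x - y)) \<in> ?R"
    by (rule kick_stepI[where s = "-1"]; (simp; fail)?; use assms p k1 v in linarith)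
  have 2: "((True, - (sin x * cos y), x - y), (False, - (cos x * sin y), x + y)) \<in> ?R"
    by (rule kick_stepI[where s = "-1"]; (simp; fail)?; use assms p k1 v in linarith)
  have 3: "((False, - (cos x * sin y), x + y), (True, sin x * cos y, y - x)) \<in> ?R"
    by (rule kick_stepI[where s = "1"]; (simp; fail)?; use assms p k1 v in linarith)
  have 4: "((True, sin x * cos y, y - x), (False, cos x * sin y, - x - y)) \<in> ?R"
    by (rule kick_stepI[where s = "1"]; (simp; fail)?; use assms p k1 v in linarith)
  have "((False, cos x * sin y, - x - y), (False, cos x * sin y, - x - y)) \<in> ?R ^^ Suc (Suc (Suc (Suc 0)))"
    by (rule relpow_Suc_I2[OF 1] relpow_Suc_I2[OF 2] relpow_Suc_I2[OF 3] relpow_Suc_I2[OF 4] relpow_0_I)+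
  then show ?thesis by (rule kick_cycleI) simp_all
qed

text \<open>The right angle gives no kick. The acute vertex is passed at
  \<open>3 / 2 * sin x\<close> and at \<open>- sin x / 2\<close>, on opposite sides, so its two
  kicks cancel.\<close>

lemma kick_cycle_acute_right:
  assumes "0 < x" "x \<le> b / 20" "b \<le> 1"
  shows "kick_cycle (- x) 0 b"
proof -
  have "x < pi" using assms pi_gt3 by linarith
  then have s: "0 < sin x" "sin x \<le> b / 20"
    using assms sin_x_le_x[of x] by (auto intro: sin_gt_zero)
  let ?R = "kick_step (- x) 0 b"
  let ?q = "3 / 2 * sin x"
  have 1: "((True, ?q, - x), (False, sin x / 2, - x)) \<in> ?R"
   and 2: "((False, sin x / 2, - x), (True, - sin x / 2, x)) \<in> ?R"
   and 3: "((True, - sin x / 2, x), (False, sin x / 2, x)) \<in> ?R"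
   and 4: "((False, sin x / 2, x), (True, ?q, - x)) \<in> ?R"
    using assms s by (auto simp: kick_step_def)
  have "((True, ?q, - x), (True, ?q, - x)) \<in> ?R ^^ Suc (Suc (Suc (Suc 0)))"
    by (rule relpow_Suc_I2[OF 1] relpow_Suc_I2[OF 2] relpow_Suc_I2[OF 3] relpow_Suc_I2[OF 4] relpow_0_I)+
  then show ?thesis by (rule kick_cycleI) simp_all
qed

text \<open>The acute vertex is passed once on the negative and twice on the positive side, the
  other one three times on the positive side. The kicks add up to
  \<open>6 * t - 12 * t + 6 * t\<close>, which vanishes only at this ratio of the defects; it is the
  boundary case that the next orbit excludes.\<close>

lemma kick_cycle_acute_third:
  assumes "0 < t" "3 * t \<le> b / 20" "b \<le> 1"
  shows "kick_cycle (- (3 * t)) t b"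
proof -
  have "5 * t < pi" using assms pi_gt3 by linarith
  then have s: "0 < sin t" "0 < sin (3 * t)" "0 < sin (5 * t)" 
      "sin t \<le> t" "sin (3 * t) \<le> 3 * t" "sin (5 * t) \<le> 5 * t"
    using assms sin_x_le_x[of t] sin_x_le_x[of "3 * t"] sin_x_le_x[of "5 * t"] by (auto intro!: sin_gt_zero)
  \<comment> \<open>This keeps the last position \<open>?q - sin t\<close> positive.\<close>
  have "sin t < sin (5 * t)" 
    by (rule sin_monotone_2pi) (use assms pi_gt3 in linarith)+
  let ?R = "kick_step (- (3 * t)) t b"
  let ?q = "sin (5 * t) + sin (3 * t) / 2"
  have 1: "((True, ?q, - 5 * t), (False, sin (3 * t) / 2, - 3 * t)) \<in> ?R"
   and 2: "((False, sin (3 * t) / 2, - 3 * t), (True, - sin (3 * t) / 2, 3 * t)) \<in> ?R"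
   and 3: "((True, - sin (3 * t) / 2, 3 * t), (False, sin (3 * t) / 2, 5 * t)) \<in> ?R"
   and 4: "((False, sin (3 * t) / 2, 5 * t), (True, ?q, - t)) \<in> ?R"
   and 5: "((True, ?q, - t), (False, ?q - sin t, t)) \<in> ?R"
   and 6: "((False, ?q - sin t, t), (True, ?q, - 5 * t)) \<in> ?R"
    using assms s \<open>sin t < sin (5 * t)\<close> by (auto simp: kick_step_def)
  have "((True, ?q, - 5 * t), (True, ?q, - 5 * t)) \<in> ?R ^^ Suc (Suc (Suc (Suc (Suc (Suc 0)))))"
    by (rule relpow_Suc_I2[OF 1] relpow_Suc_I2[OF 2] relpow_Suc_I2[OF 3] relpow_Suc_I2[OF 4]
        relpow_Suc_I2[OF 5] relpow_Suc_I2[OF 6] relpow_0_I)+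
  then show ?thesis by (rule kick_cycleI) simp_all
qed

text \<open>This orbit of period 16 was found by a computer search over the sides on which the vertices are passed,
  for the linearised recursion. With \<open>sin\<close> it closes up exactly because it is invariant under time reversal.\<close>

lemma kick_cycle_acute_less_third:
  assumes "0 < t" "3 * t < x" "x \<le> b / 20" "b \<le> 1"
  shows "kick_cycle (- x) t b"
proof -
  have xb: "x \<le> 1 / 20" "0 < x" using assms by linarith+
  have pi: "3 < pi" by (rule pi_gt3)
  define s a1 a2 a3 a4 a5 where d: "s = sin x" "a1 = sin (x - 2 * t)" "a2 = sin (x + 2 * t)"
    "a3 = sin (3 * x - 2 * t)" "a4 = sin (3 * x - 4 * t)" "a5 = sin (x - 4 * t)"
  have mono: "sin u < sin w" if "- 1 \<le> u" "u < w" "w \<le> 1" for u w :: real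
    by (rule sin_monotone_2pi) (use that pi in linarith)+
  have 0: "0 < s" "0 < a1" "0 < a2" "0 < a3" "0 < a4"
    unfolding d using assms xb pi by (auto intro!: sin_gt_zero)
  have ub: "s \<le> x" "a1 \<le> x" "a2 \<le> 2 * x" "a3 \<le> 3 * x" "a4 \<le> 3 * x" "\<bar>a5\<bar> \<le> x"
    unfolding d using assms xb sin_x_le_x[of x] sin_x_le_x[of "x - 2 * t"] sin_x_le_x[of "x + 2 * t"]
      sin_x_le_x[of "3 * x - 2 * t"] sin_x_le_x[of "3 * x - 4 * t"] abs_sin_x_le_abs_x[of "x - 4 * t"]
    by (auto simp: abs_if split: if_splits)
  \<comment> \<open>Here \<open>a2 < a4\<close>, like \<open>sin (4 * t - x) < a1\<close> below,
    amounts exactly to \<open>3 * t < x\<close>.\<close>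
  have o: "a1 < s" "s < a2" "a5 < a1" "a2 < a4"
    unfolding d using assms xb by (auto intro!: mono)
  have "sin (4 * t - x) < a1" unfolding d using assms xb by (auto intro!: mono)
  moreover have "a5 = - sin (4 * t - x)" unfolding d by (metis minus_diff_eq sin_minus)
  ultimately have o2: "0 < a1 + a5" by simp
  \<comment> \<open>The starting position \<open>a\<close> is free. The four bounds on it say
    \<open>q5 > 0\<close>, \<open>q10 > 0\<close>, \<open>q6 < 0\<close> and \<open>q9 < 0\<close>;
    the remaining signs follow from these.\<close>
  have "max a3 (a3 + a4 + a5 + a1 - a2 - s) < min (a3 + a4) (a3 + a4 + a5 + a1 - a2)"
    using 0 o o2 by auto
  from dense[OF this] obtain a where
    "max a3 (a3 + a4 + a5 + a1 - a2 - s) < a" "a < min (a3 + a4) (a3 + a4 + a5 + a1 - a2)" by blast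
  then have a: "a3 < a" "a3 + a4 + a5 + a1 - a2 - s < a" "a < a3 + a4" "a < a3 + a4 + a5 + a1 - a2" by simp_all
  let ?R = "kick_step (- x) t b"
  have sn: "sin (2 * t - x) = - a1" "sin (- x) = - s" "sin (2 * t - 3 * x) = - a3" "sin (4 * t - 3 * x) = - a4"
    "sin (4 * t - x) = - a5" "sin (- x - 2 * t) = - a2"
    unfolding d using sin_minus[of "x - 2 * t"] sin_minus[of "3 * x - 2 * t"] sin_minus[of "3 * x - 4 * t"]
      sin_minus[of "x - 4 * t"] sin_minus[of "x + 2 * t"] by simp_all
  note sd = d[symmetric]
  \<comment> \<open>The orbit goes from \<open>q0\<close> up to \<open>q2\<close>, returns through
    \<open>q1\<close> and \<open>q0\<close> (the missing indices 3 and 4), goes on to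
    \<open>q10\<close> and retraces its way. Each increment occurs once in each direction, so the
    positions close up for every \<open>a\<close>.\<close>
  define q0 q1 q2 q5 q6 q7 q8 q9 q10 where q: "q0 = a" "q1 = q0 + a1" "q2 = q1 + s" "q5 = q0 - a3"
    "q6 = q5 - a4" "q7 = q6 - a5" "q8 = q7 - a1" "q9 = q8 + a2" "q10 = q9 + s"
  have neg: "q6 < 0" "q7 < 0" "q8 < 0" "q9 < 0" and pos: "0 < q0" "0 < q1" "0 < q2" "0 < q5" "0 < q10"
    using a 0 o o2 unfolding q by linarith+
  have a5: "- x \<le> a5" "a5 \<le> x" using ub(6) by linarith+
  have le: "q0 \<le> 6 * x" using a ub(4,5) unfolding q by linarith
  have "q1 \<le> b" "q2 \<le> b" "q5 \<le> b" "q10 \<le> b" "q0 \<le> b"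
    using le 0 ub(1-3) a5 assms(3) xb unfolding q by linarith+
  moreover have "- b \<le> q8" "- b \<le> q6" "- b \<le> q7" "- b \<le> q9"
    using pos(1) 0 ub(1-5) a5 assms(3) xb unfolding q by linarith+
  ultimately have bd: "\<bar>q0\<bar> \<le> b" "\<bar>q1\<bar> \<le> b" "\<bar>q2\<bar> \<le> b" "\<bar>q5\<bar> \<le> b" "\<bar>q6\<bar> \<le> b" "\<bar>q7\<bar> \<le> b"
    "\<bar>q8\<bar> \<le> b" "\<bar>q9\<bar> \<le> b" "\<bar>q10\<bar> \<le> b"
    using neg pos by (auto simp: abs_le_iff)
  have df: "q1 - q0 = a1" "q2 - q1 = s" "q1 - q2 = - s" "q0 - q1 = - a1" "q5 - q0 = - a3" "q6 - q5 = - a4"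
    "q7 - q6 = - a5" "q8 - q7 = - a1" "q9 - q8 = a2" "q10 - q9 = s" "q9 - q10 = - s" "q8 - q9 = - a2"
    "q7 - q8 = a1" "q6 - q7 = a5" "q5 - q6 = a4" "q0 - q5 = a3"
    unfolding q by simp_all
  have nz: "q0 \<noteq> 0" "q1 \<noteq> 0" "q2 \<noteq> 0" "q5 \<noteq> 0" "q6 \<noteq> 0" "q7 \<noteq> 0" "q8 \<noteq> 0" "q9 \<noteq> 0" "q10 \<noteq> 0"
    using neg pos by auto
  have pb: "\<bar>x - 2 * t\<bar> \<le> b" "\<bar>x\<bar> \<le> b" "\<bar>2 * t - x\<bar> \<le> b" "\<bar>2 * t - 3 * x\<bar> \<le> b" "\<bar>4 * t - 3 * x\<bar> \<le> b"
    "\<bar>4 * t - x\<bar> \<le> b" "\<bar>x + 2 * t\<bar> \<le> b" "\<bar>- x - 2 * t\<bar> \<le> b" "\<bar>x - 4 * t\<bar> \<le> b" "\<bar>3 * x - 4 * t\<bar> \<le> b"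
    "\<bar>3 * x - 2 * t\<bar> \<le> b"
    using assms unfolding abs_le_iff by linarith+
  have 1: "((True, q0, x - 2 * t), (False, q1, x)) \<in> ?R"
    by (rule kick_stepI[where s = "1"])
      (simp_all add: nz neg pos bd pb df sn sd)
  have 2: "((False, q1, x), (True, q2, - x)) \<in> ?R"
    by (rule kick_stepI[where s = "1"])
      (simp_all add: nz neg pos bd pb df sn sd)
  have 3: "((True, q2, - x), (False, q1, 2 * t - x)) \<in> ?R"
    by (rule kick_stepI[where s = "1"])
      (simp_all add: nz neg pos bd pb df sn sd)
  have 4: "((False, q1, 2 * t - x), (True, q0, 2 * t - 3 * x)) \<in> ?R"
    by (rule kick_stepI[where s = "1"])
      (simp_all add: nz neg pos bd pb df sn sd)
  have 5: "((True, q0, 2 * t - 3 * x), (False, q5, 4 * t - 3 * x)) \<in> ?R"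
    by (rule kick_stepI[where s = "1"])
      (simp_all add: nz neg pos bd pb df sn sd)
  have 6: "((False, q5, 4 * t - 3 * x), (True, q6, 4 * t - x)) \<in> ?R"
    by (rule kick_stepI[where s = "-1"])
      (simp_all add: nz neg pos bd pb df sn sd)
  have 7: "((True, q6, 4 * t - x), (False, q7, 2 * t - x)) \<in> ?R"
    by (rule kick_stepI[where s = "-1"])
      (simp_all add: nz neg pos bd pb df sn sd)
  have 8: "((False, q7, 2 * t - x), (True, q8, x + 2 * t)) \<in> ?R"
    by (rule kick_stepI[where s = "-1"])
      (simp_all add: nz neg pos bd pb df sn sd)
  have 9: "((True, q8, x + 2 * t), (False, q9, x)) \<in> ?R"
    by (rule kick_stepI[where s = "-1"])
      (simp_all add: nz neg pos bd pb df sn sd)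
  have 10: "((False, q9, x), (True, q10, - x)) \<in> ?R"
    by (rule kick_stepI[where s = "1"])
      (simp_all add: nz neg pos bd pb df sn sd)
  have 11: "((True, q10, - x), (False, q9, - x - 2 * t)) \<in> ?R"
    by (rule kick_stepI[where s = "-1"])
      (simp_all add: nz neg pos bd pb df sn sd)
  have 12: "((False, q9, - x - 2 * t), (True, q8, x - 2 * t)) \<in> ?R"
    by (rule kick_stepI[where s = "-1"])
      (simp_all add: nz neg pos bd pb df sn sd)
  have 13: "((True, q8, x - 2 * t), (False, q7, x - 4 * t)) \<in> ?R"
    by (rule kick_stepI[where s = "-1"])
      (simp_all add: nz neg pos bd pb df sn sd)
  have 14: "((False, q7, x - 4 * t), (True, q6, 3 * x - 4 * t)) \<in> ?R"
    by (rule kick_stepI[where s = "-1"])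
      (simp_all add: nz neg pos bd pb df sn sd)
  have 15: "((True, q6, 3 * x - 4 * t), (False, q5, 3 * x - 2 * t)) \<in> ?R"
    by (rule kick_stepI[where s = "1"])
      (simp_all add: nz neg pos bd pb df sn sd)
  have 16: "((False, q5, 3 * x - 2 * t), (True, q0, x - 2 * t)) \<in> ?R"
    by (rule kick_stepI[where s = "1"])
      (simp_all add: nz neg pos bd pb df sn sd)
  have "((True, q0, x - 2 * t), (True, q0, x - 2 * t)) \<in> ?R ^^
     Suc (Suc (Suc (Suc (Suc (Suc (Suc (Suc (Suc (Suc (Suc (Suc (Suc (Suc (Suc (Suc 0)))))))))))))))"
    by (rule relpow_Suc_I2[OF 1] relpow_Suc_I2[OF 2] relpow_Suc_I2[OF 3] relpow_Suc_I2[OF 4]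
        relpow_Suc_I2[OF 5] relpow_Suc_I2[OF 6] relpow_Suc_I2[OF 7] relpow_Suc_I2[OF 8]
        relpow_Suc_I2[OF 9] relpow_Suc_I2[OF 10] relpow_Suc_I2[OF 11] relpow_Suc_I2[OF 12]
        relpow_Suc_I2[OF 13] relpow_Suc_I2[OF 14] relpow_Suc_I2[OF 15] relpow_Suc_I2[OF 16] relpow_0_I)+
  then show ?thesis by (rule kick_cycleI) simp_all
qed

text \<open>Some vertex \<open>i\<close> is acute. If all other defects exceeded
  \<open>- e i / 3\<close>, the sum of the four would be positive; so some \<open>j\<close> falls
  into the range covered by the four orbits above.\<close>

lemma kick_cycle_pair:
  fixes e :: "nat \<Rightarrow> real"
  assumes sum: "e 0 + e 1 + e 2 + e 3 = 0" and small: "\<And>i. i < 4 \<Longrightarrow> \<bar>e i\<bar> \<le> b / 20" and b: "b \<le> 1"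
    and nz: "\<exists>i<4. e i \<noteq> 0"
  shows "\<exists>i j. i < j \<and> j < 4 \<and> kick_cycle (e i) (e j) b"
proof -
  have good: "kick_cycle (e i) (e j) b" if "i < 4" "j < 4" "e i < 0" "e j \<le> - e i / 3" for i j
  proof -
    have "e j < 0 \<or> e j = 0 \<or> 0 < e j \<and> 3 * e j < - e i \<or> e i = - (3 * e j) \<and> 0 < e j"
      using that by linarith
    then consider "e j < 0" | "e j = 0" | "0 < e j" "3 * e j < - e i" | "e i = - (3 * e j)" "0 < e j"
      by blast
    then show ?thesis
    proof cases
      case 1
      then show ?thesis using kick_cycle_acute_acute[of "- e i" b "- e j"] that small[of i] small[of j] b by auto
    next
      case 2
      then show ?thesis using kick_cycle_acute_right[of "- e i" b] that small[of i] b by auto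
    next
      case 3
      then show ?thesis using kick_cycle_acute_less_third[of "e j" "- e i" b] that small[of i] b by auto
    next
      case 4
      then show ?thesis using kick_cycle_acute_third[of "e j" b] that small[of i] b by auto
    qed
  qed
  have "\<exists>i<4. e i < 0"
  proof (rule ccontr)
    assume "\<not> ?thesis"
    then have *: "\<And>i. i < 4 \<Longrightarrow> 0 \<le> e i" by (meson not_less)
    have "0 \<le> e 0" "0 \<le> e 1" "0 \<le> e 2" "0 \<le> e 3" using * by simp_all
    then have "e 0 = 0" "e 1 = 0" "e 2 = 0" "e 3 = 0" using sum by linarith+
    moreover obtain i where "i < 4" "e i \<noteq> 0" using nz by blast
    moreover have "i = 0 \<or> i = 1 \<or> i = 2 \<or> i = 3" using \<open>i < 4\<close> by auto
    ultimately show False by auto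
  qed
  then obtain i where i: "i < 4" "e i < 0" by blast
  have "\<exists>j<4. j \<noteq> i \<and> e j \<le> - e i / 3"
  proof (rule ccontr)
    assume "\<not> ?thesis"
    then have *: "\<And>j. j < 4 \<Longrightarrow> j \<noteq> i \<Longrightarrow> - e i / 3 < e j" by (meson not_less)
    have "i = 0 \<or> i = 1 \<or> i = 2 \<or> i = 3" using i by auto
    then show False using *[of 0] *[of 1] *[of 2] *[of 3] sum by auto
  qed
  then obtain j where j: "j < 4" "j \<noteq> i" "e j \<le> - e i / 3" by blast
  have "kick_cycle (e i) (e j) b" using good i j by blast
  then show ?thesis using i j kick_cycle_commute by (metis linorder_neqE_nat)
qed

section \<open>Chords between corners\<close>

lemma real_multiple_of_cis:
  fixes z :: complex
  assumes "Im (z * cis (- t)) = 0"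
  shows "z = complex_of_real (Re (z * cis (- t))) * cis t"
proof -
  have "z * cis (- t) = complex_of_real (Re (z * cis (- t)))"
    using assms by (simp add: complex_eq_iff)
  then have "z * cis (- t) * cis t = complex_of_real (Re (z * cis (- t))) * cis t" by simp
  then show ?thesis by (simp add: mult.assoc cis_mult)
qed

text \<open>\<open>r * sin (A - \<nu>)\<close> is the signed distance between \<open>P\<close> and
  the line of direction \<open>\<omega> + \<nu>\<close> through the bounce point, and similarly at
  \<open>P'\<close>. So \<open>step\<close> puts both bounce points on one such line; the bounds on
  \<open>r\<close>, \<open>r'\<close> and \<open>cos \<nu>\<close> give their order on it.\<close>

lemma chord_between_vertices:
  fixes P P' :: complex
  assumes P': "P' = P + complex_of_real L * cis \<omega>"
    and q: "r * sin (A - \<nu>) = q * L" and q': "r' * sin (B + \<nu>) = q' * L"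
    and step: "q' = q + sin \<nu>"
    and r: "0 \<le> r" "r \<le> L / 4" "0 \<le> r'" "r' \<le> L / 4" and \<nu>: "1 / 2 < cos \<nu>" and L: "0 < L"
  shows "\<exists>l>0. P' + complex_of_real r' * cis (\<omega> + pi - B) - (P + complex_of_real r * cis (\<omega> + A))
                = complex_of_real l * cis (\<omega> + \<nu>)"
proof -
  define z where "z = P' + complex_of_real r' * cis (\<omega> + pi - B) - (P + complex_of_real r * cis (\<omega> + A))"
  have z: "z * cis (- (\<omega> + \<nu>)) = complex_of_real L * cis (- \<nu>)
      + complex_of_real r' * cis (pi - (B + \<nu>)) - complex_of_real r * cis (A - \<nu>)"
    unfolding z_def P' by (simp add: algebra_simps cis_mult)
  have "Im (z * cis (- (\<omega> + \<nu>))) = - L * sin \<nu> + r' * sin (B + \<nu>) - r * sin (A - \<nu>)"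
    unfolding z by simp
  also have "\<dots> = 0" unfolding q q' step by (simp add: algebra_simps)
  finally have im: "Im (z * cis (- (\<omega> + \<nu>))) = 0" .
  have "Re (z * cis (- (\<omega> + \<nu>))) = L * cos \<nu> - r' * cos (B + \<nu>) - r * cos (A - \<nu>)"
    unfolding z by simp
  moreover have "r' * cos (B + \<nu>) \<le> r'" "r * cos (A - \<nu>) \<le> r"
    using r by (simp_all add: mult_left_le)
  moreover have "L / 2 < L * cos \<nu>" using mult_strict_left_mono[OF \<nu> L] by simp
  ultimately have "0 < Re (z * cis (- (\<omega> + \<nu>)))" using r by linarith
  then show ?thesis using real_multiple_of_cis[OF im] unfolding z_def by blast
qed

text \<open>A reflection in a side through \<open>P\<close> preserves the distance of the path from
  \<open>P\<close>, hence the common value \<open>d\<close>. The sign of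
  \<open>d * sin (A + B)\<close> ensures that the points are met in this order.\<close>

lemma chord_across_corner:
  fixes P :: complex
  assumes r1: "r1 * sin (B + \<nu>) = d" and r2: "r2 * sin (A + 2 * B + \<nu>) = d"
    and r: "0 < r1" "0 < r2" and d: "0 < d * sin (A + B)"
  shows "\<exists>l>0. P + complex_of_real r2 * cis (\<omega> + pi + A) - (P + complex_of_real r1 * cis (\<omega> + pi - B))
                = complex_of_real l * cis (\<omega> - 2 * B - \<nu>)"
proof -
  define X where "X = B + \<nu>"
  define Y where "Y = A + 2 * B + \<nu>"
  define z where "z = P + complex_of_real r2 * cis (\<omega> + pi + A) - (P + complex_of_real r1 * cis (\<omega> + pi - B))"
  define t where "t = \<omega> - 2 * B - \<nu>"
  have z: "z * cis (- t) = complex_of_real r2 * cis (Y + pi) - complex_of_real r1 * cis (X + pi)"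
    unfolding z_def t_def X_def Y_def by (simp add: algebra_simps cis_mult)
  have im: "Im (z * cis (- t)) = 0" unfolding z using r1 r2 by (simp add: X_def Y_def)
  have re: "Re (z * cis (- t)) = r1 * cos X - r2 * cos Y" unfolding z by simp
  have d1: "d = r1 * sin X" and d2: "d = r2 * sin Y" using r1 r2 by (auto simp: X_def Y_def)
  have "d * (r1 * cos X - r2 * cos Y) = r1 * cos X * (r2 * sin Y) - r2 * cos Y * (r1 * sin X)"
    using d1 d2 by (simp add: algebra_simps)
  also have "\<dots> = r1 * r2 * sin (Y - X)" by (simp add: sin_diff algebra_simps)
  also have "Y - X = A + B" by (simp add: X_def Y_def)
  finally have "d * (r1 * cos X - r2 * cos Y) = r1 * r2 * sin (A + B)" .
  then have "d * d * (r1 * cos X - r2 * cos Y) = r1 * r2 * (d * sin (A + B))"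
    by (simp add: algebra_simps)
  moreover have "0 < r1 * r2 * (d * sin (A + B))" using r d by simp
  moreover have "0 \<le> d * d" by simp
  ultimately have "0 < r1 * cos X - r2 * cos Y"
    by (metis zero_less_mult_iff not_less order.asym mult_nonneg_nonpos)
  moreover have "z = complex_of_real (r1 * cos X - r2 * cos Y) * cis t"
    using real_multiple_of_cis[OF im] unfolding re .
  ultimately show ?thesis unfolding z_def t_def by (intro exI conjI)
qed

text \<open>A line of slope angle \<open>\<nu>\<close> at signed distance \<open>q * L\<close> from
  \<open>P\<close> meets the axis at distance \<open>- (q / sin \<nu>) * L\<close> from
  \<open>P\<close>. The sign \<open>\<tau>\<close> covers the mirror image.\<close>

lemma chord_to_axis:
  fixes P :: complex
  assumes \<tau>: "\<tau> = 1 \<or> \<tau> = -1" and q: "r * sin (A - \<nu>) = q * L" and r: "0 < r"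
    and A: "0 < sin A" and \<nu>: "sin \<nu> < 0"
  shows "\<exists>l>0. P + complex_of_real (- (q / sin \<nu>) * L) * cis \<omega> - (P + complex_of_real r * cis (\<omega> + \<tau> * A))
                = complex_of_real l * cis (\<omega> + \<tau> * \<nu>)"
proof -
  define z where "z = P + complex_of_real (- (q / sin \<nu>) * L) * cis \<omega> - (P + complex_of_real r * cis (\<omega> + \<tau> * A))"
  have z: "z * cis (- (\<omega> + \<tau> * \<nu>)) = complex_of_real (- (q / sin \<nu>) * L) * cis (- (\<tau> * \<nu>)) - complex_of_real r * cis (\<tau> * (A - \<nu>))"
    unfolding z_def by (simp add: algebra_simps cis_mult)
  have im: "Im (z * cis (- (\<omega> + \<tau> * \<nu>))) = 0"
  proof -
    have "Im (z * cis (- (\<omega> + \<tau> * \<nu>))) = \<tau> * (q / sin \<nu> * sin \<nu> * L - r * sin (A - \<nu>))"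
      unfolding z using \<tau> by (auto simp: algebra_simps sin_diff)
    then show ?thesis using \<nu> q by simp
  qed
  have "sin \<nu> * Re (z * cis (- (\<omega> + \<tau> * \<nu>))) = - (q * L) * cos \<nu> - r * cos (A - \<nu>) * sin \<nu>"
    unfolding z using \<tau> \<nu> by (auto simp: field_simps cos_diff)
  also have "\<dots> = - r * (sin (A - \<nu>) * cos \<nu> + cos (A - \<nu>) * sin \<nu>)"
    unfolding q[symmetric] by (simp add: algebra_simps)
  also have "sin (A - \<nu>) * cos \<nu> + cos (A - \<nu>) * sin \<nu> = sin A"
    using sin_add[of "A - \<nu>" \<nu>] by simp
  finally have "sin \<nu> * Re (z * cis (- (\<omega> + \<tau> * \<nu>))) < 0" using r A by simp
  then have "0 < Re (z * cis (- (\<omega> + \<tau> * \<nu>)))" using \<nu> by (simp add: mult_less_0_iff)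
  then show ?thesis using real_multiple_of_cis[OF im] unfolding z_def by blast
qed

section \<open>Bounce states and single steps past a vertex\<close>

lemma cis_pi_shift: "cis (x + pi) = - cis x" "cis (x - pi) = - cis x" "cis (x + 2 * pi) = cis x" "cis (x - 2 * pi) = cis x"
  by (simp_all add: complex_eq_iff cos_add sin_add cos_diff sin_diff)

text \<open>A state consists of the side just hit, the bounce point and the outgoing direction.\<close>

definition bounce_link :: "(nat \<Rightarrow> complex) \<Rightarrow> (nat \<times> complex \<times> complex) rel" where
  "bounce_link v = {((s, p, u), (s', p', u')). s < 4 \<and> s' < 4 \<and> s \<noteq> s'
     \<and> p \<in> open_segment (v s) (v (Suc s)) \<and> p' \<in> open_segment (v s') (v (Suc s'))
     \<and> (\<exists>l>0. p' - p = complex_of_real l * u) \<and> u' = reflect_dir (v (Suc s') - v s') u}"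

text \<open>\<open>w\<close> stands for the unit direction of side \<open>k\<close> seen from its
  end \<open>P\<close>. With \<open>w = cis t\<close> the factor \<open>w\<^sup>2\<close> turns
  reflection into arithmetic of angles, and it is the same from either end of the side.\<close>

definition ray :: "(nat \<Rightarrow> complex) \<Rightarrow> real \<Rightarrow> nat \<Rightarrow> complex \<Rightarrow> complex \<Rightarrow> bool" where
  "ray v m k P w \<longleftrightarrow> k < 4
     \<and> (\<forall>r. 0 < r \<and> r < m \<longrightarrow> P + complex_of_real r * w \<in> open_segment (v k) (v (Suc k)))
     \<and> (\<forall>u. reflect_dir (v (Suc k) - v k) u = w\<^sup>2 * cnj u)"

lemma ray_mono: "ray v M k P w \<Longrightarrow> m \<le> M \<Longrightarrow> ray v m k P w"
  by (auto simp: ray_def)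

lemma bounce_linkI:
  assumes "ray v m k P w" "ray v m' k' P' w'" "k \<noteq> k'" "0 < r" "r < m" "0 < r'" "r' < m'"
    and "\<exists>l>0. (P' + complex_of_real r' * w') - (P + complex_of_real r * w) = complex_of_real l * u"
    and "u' = w'\<^sup>2 * cnj u"
  shows "((k, P + complex_of_real r * w, u), (k', P' + complex_of_real r' * w', u')) \<in> bounce_link v"
  using assms unfolding bounce_link_def ray_def by auto

lemma reflect_dir_unit:
  assumes "norm w = 1" "l \<noteq> 0"
  shows "reflect_dir (complex_of_real l * w) u = w\<^sup>2 * cnj u"
proof -
  have "w * cnj w = 1" using assms by (simp add: complex_norm_square[symmetric])
  moreover from this have "w \<noteq> 0" by auto
  ultimately have "cnj w = 1 / w" by (simp add: field_simps)
  then show ?thesis using assms(2) by (simp add: reflect_dir_def power2_eq_square)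
qed

lemma ray_of_side:
  assumes s: "v (Suc k) = v k + complex_of_real l * w" and "k < 4" "norm w = 1" "0 < l"
  shows "ray v l k (v k) w" "ray v l k (v (Suc k)) (- w)"
proof -
  have "w \<noteq> 0" using assms by auto
  have on: "v k + complex_of_real r * w \<in> open_segment (v k) (v (Suc k))" if "0 < r" "r < l" for r
  proof -
    have "v k + complex_of_real r * w = (1 - r / l) *\<^sub>R v k + (r / l) *\<^sub>R v (Suc k)"
      using that assms by (simp add: scaleR_conv_of_real algebra_simps)
    moreover have "0 < r / l" "r / l < 1" using that by auto
    moreover have "v k \<noteq> v (Suc k)" using s \<open>w \<noteq> 0\<close> assms(4) by simp
    ultimately show ?thesis unfolding in_segment by blast
  qed
  have "v (Suc k) + complex_of_real r * - w \<in> open_segment (v k) (v (Suc k))" if "0 < r" "r < l" for r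
    using on[of "l - r"] that by (simp add: s algebra_simps)
  with on show "ray v l k (v k) w" "ray v l k (v (Suc k)) (- w)"
    using assms reflect_dir_unit[of w l] by (auto simp: ray_def)
qed

text \<open>The axis runs from \<open>P\<close> to \<open>P'\<close> in direction \<open>\<omega>\<close>. The angles between the axis and the sides are signed:
  \<open>A\<close> and \<open>B\<close> are positive for sides to the left of the axis, \<open>A'\<close> for a side to the left of the reversed axis.\<close>

lemma diagonal_step:
  assumes P': "P' = P + complex_of_real L * cis \<omega>"
    and rays: "ray v m k1 P (cis (\<omega> + A))" "ray v m k2 P' (cis (\<omega> + pi - B))" "ray v m k3 P' (cis (\<omega> + pi + A'))"
      "k1 \<noteq> k2" "k2 \<noteq> k3"
    and \<sigma>: "\<sigma> = 1 \<or> \<sigma> = -1" "0 < \<sigma> * q'" and AB: "A' + B = \<sigma> * (pi / 2 + f)" and f: "\<bar>f\<bar> < 1"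
    and r: "0 < r" "r < m" "r \<le> L / 4" "r * sin (A - \<phi>) = q * L"
    and r': "0 < r'" "r' < m" "r' \<le> L / 4" "r' * sin (B + \<phi>) = q' * L"
    and r'': "0 < r''" "r'' < m" "r'' * sin (A' - \<phi>') = q' * L"
    and step: "q' = q + sin \<phi>" "\<phi>' = \<phi> + 2 * \<sigma> * f" and c: "1 / 2 < cos \<phi>" "0 < L"
  shows "((k1, P + complex_of_real r * cis (\<omega> + A), cis (\<omega> + \<phi>)),
          (k3, P' + complex_of_real r'' * cis (\<omega> + pi + A'), cis (\<omega> + pi + \<phi>'))) \<in> bounce_link v ^^ 2"
proof -
  have 1: "((k1, P + complex_of_real r * cis (\<omega> + A), cis (\<omega> + \<phi>)),
      (k2, P' + complex_of_real r' * cis (\<omega> + pi - B), cis (\<omega> - 2 * B - \<phi>))) \<in> bounce_link v"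
  proof (rule bounce_linkI[OF rays(1,2,4)])
    have "cis (\<omega> - 2 * B - \<phi>) = cis ((\<omega> - 2 * B - \<phi>) + 2 * pi)"
      by (simp add: complex_eq_iff)
    also have "\<dots> = (cis (\<omega> + pi - B))\<^sup>2 * cnj (cis (\<omega> + \<phi>))"
      by (simp add: cis_cnj power2_eq_square cis_mult algebra_simps)
    finally show "cis (\<omega> - 2 * B - \<phi>) = (cis (\<omega> + pi - B))\<^sup>2 * cnj (cis (\<omega> + \<phi>))" .
  qed (use r r' chord_between_vertices[OF P' r(4) r'(4) step(1)] c in auto)
  \<comment> \<open>The kick makes the two angles supplementary up to the sign
    \<open>\<sigma>\<close>, so the distance from the vertex is again \<open>q' * L\<close> in the
    reversed frame.\<close>
  have e: "A' + 2 * B + \<phi> = \<sigma> * pi - (A' - \<phi>')"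
    using AB step(2) by (simp add: algebra_simps)
  have s: "sin (A' + 2 * B + \<phi>) = sin (A' - \<phi>')"
    unfolding e using \<sigma>(1) by (auto simp: sin_diff)
  have "0 < sin (pi / 2 + f)"
    using f pi_gt3 by (intro sin_gt_zero) auto
  then have "0 < \<sigma> * q' * L * sin (pi / 2 + f)" using \<sigma>(2) c(2) by simp
  moreover have "sin (\<sigma> * (pi / 2 + f)) = \<sigma> * sin (pi / 2 + f)"
    using \<sigma>(1) sin_minus[of "pi / 2 + f"] by fastforce
  ultimately have "0 < (q' * L) * sin (A' + B)"
    unfolding AB by (simp add: algebra_simps)
  moreover have "r'' * sin (A' + 2 * B + \<phi>) = q' * L" using r''(3) s by simp
  ultimately have ch: "\<exists>l>0. P' + complex_of_real r'' * cis (\<omega> + pi + A') - (P' + complex_of_real r' * cis (\<omega> + pi - B))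
                = complex_of_real l * cis (\<omega> - 2 * B - \<phi>)"
    using chord_across_corner[OF r'(4) _ r'(1) r''(1)] by blast
  have 2: "((k2, P' + complex_of_real r' * cis (\<omega> + pi - B), cis (\<omega> - 2 * B - \<phi>)),
      (k3, P' + complex_of_real r'' * cis (\<omega> + pi + A'), cis (\<omega> + pi + \<phi>'))) \<in> bounce_link v"
  proof (rule bounce_linkI[OF rays(2,3,5) r'(1,2) r''(1,2) ch])
    \<comment> \<open>Two reflections turn the direction by twice the angle between the sides,
      \<open>\<sigma> * (pi + 2 * f)\<close>. The half turn is absorbed by reversing the axis, and
      the rest is the kick.\<close>
    have "\<omega> + \<phi> + 2 * (A' + B) + 2 * pi = \<omega> + pi + \<phi>' + (\<sigma> * pi + pi)"
      unfolding AB using step(2) by (simp add: algebra_simps)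
    moreover have "\<sigma> * pi + pi = 2 * pi \<or> \<sigma> * pi + pi = 0" using \<sigma>(1) by auto
    ultimately have "cis (\<omega> + pi + \<phi>') = cis (\<omega> + \<phi> + 2 * (A' + B) + 2 * pi)"
      using cis_pi_shift(3)[of "\<omega> + pi + \<phi>'"] by (metis add.right_neutral)
    also have "\<dots> = (cis (\<omega> + pi + A'))\<^sup>2 * cnj (cis (\<omega> - 2 * B - \<phi>))"
      by (simp add: cis_cnj power2_eq_square cis_mult algebra_simps)
    finally show "cis (\<omega> + pi + \<phi>') = (cis (\<omega> + pi + A'))\<^sup>2 * cnj (cis (\<omega> - 2 * B - \<phi>))" .
  qed
  from 1 2 show ?thesis by (auto simp: numeral_2_eq_2)
qed

text \<open>Here the axis is a side, \<open>\<tau>\<close> tells on which side of it the interior lies, and \<open>q\<close>, \<open>\<phi>\<close> are already folded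
  back into the interior, so that \<open>q\<close> is positive.\<close>

lemma side_step_same:
  assumes P': "P' = P + complex_of_real L * cis \<omega>" and \<tau>: "\<tau> = 1 \<or> \<tau> = -1"
    and rays: "ray v m k1 P (cis (\<omega> + \<tau> * (pi / 2 + e)))" "ray v m k2 P' (cis (\<omega> + pi - \<tau> * (pi / 2 + f)))" "k1 \<noteq> k2"
    and r: "0 < r" "r < m" "r \<le> L / 4" "r * cos (\<phi> - e) = q * L"
    and r': "0 < r'" "r' < m" "r' \<le> L / 4" "r' * cos (\<phi>' - f) = q' * L"
    and step: "q' = q + sin \<phi>" "\<phi>' = \<phi> + 2 * f" and c: "1 / 2 < cos \<phi>" "0 < L"
  shows "((k1, P + complex_of_real r * cis (\<omega> + \<tau> * (pi / 2 + e)), cis (\<omega> + \<tau> * \<phi>)),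
          (k2, P' + complex_of_real r' * cis (\<omega> + pi - \<tau> * (pi / 2 + f)), cis (\<omega> + pi - \<tau> * \<phi>'))) \<in> bounce_link v"
proof (rule bounce_linkI[OF rays r(1,2) r'(1,2)])
  \<comment> \<open>Multiplying angles and distances by \<open>\<tau>\<close> reduces both
    orientations to \<open>chord_between_vertices\<close>.\<close>
  have 1: "r * sin (\<tau> * (pi / 2 + e) - \<tau> * \<phi>) = \<tau> * q * L"
    using r(4) \<tau> sin_add[of "pi / 2" "e - \<phi>"] sin_minus[of "pi / 2 + e - \<phi>"] cos_minus[of "\<phi> - e"]
    by (auto simp: algebra_simps)
  have 2: "r' * sin (\<tau> * (pi / 2 + f) + \<tau> * \<phi>) = \<tau> * q' * L"
    using r'(4) \<tau> sin_add[of "pi / 2" "f + \<phi>"] sin_minus[of "pi / 2 + f + \<phi>"] unfolding step(2)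
    by (auto simp: algebra_simps)
  have 3: "\<tau> * q' = \<tau> * q + sin (\<tau> * \<phi>)" using step(1) \<tau> by auto
  have 4: "1 / 2 < cos (\<tau> * \<phi>)" using c(1) \<tau> by auto
  show "\<exists>l>0. P' + complex_of_real r' * cis (\<omega> + pi - \<tau> * (pi / 2 + f)) - (P + complex_of_real r * cis (\<omega> + \<tau> * (pi / 2 + e)))
      = complex_of_real l * cis (\<omega> + \<tau> * \<phi>)"
    using chord_between_vertices[OF P' 1 2 3 _ r(3) _ r'(3) 4 c(2)] r(1) r'(1) by simp
  have "cis (\<omega> + pi - \<tau> * \<phi>') = cis (2 * (\<omega> + pi - \<tau> * (pi / 2 + f)) - (\<omega> + \<tau> * \<phi>))"
    unfolding step(2) using \<tau>
    by (auto simp: complex_eq_iff cos_add sin_add cos_diff sin_diff algebra_simps)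
  also have "\<dots> = (cis (\<omega> + pi - \<tau> * (pi / 2 + f)))\<^sup>2 * cnj (cis (\<omega> + \<tau> * \<phi>))"
    by (simp add: cis_cnj power2_eq_square cis_mult algebra_simps)
  finally show "cis (\<omega> + pi - \<tau> * \<phi>') = (cis (\<omega> + pi - \<tau> * (pi / 2 + f)))\<^sup>2 * cnj (cis (\<omega> + \<tau> * \<phi>))" .
qed

text \<open>The unfolded path crosses the axis between the two vertices. In the quadrilateral this
  is a bounce off side \<open>k0\<close>, which flips the signs of the folded position and angle.
  The second chord is treated as the first one, seen from \<open>P'\<close> and run
  backwards.\<close>

lemma side_step_cross:
  assumes P': "P' = P + complex_of_real L * cis \<omega>" and \<tau>: "\<tau> = 1 \<or> \<tau> = -1"
    and rays: "ray v m k1 P (cis (\<omega> + \<tau> * (pi / 2 + e)))" "ray v m k2 P' (cis (\<omega> + pi - \<tau> * (pi / 2 + f)))"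
      "ray v L k0 P (cis \<omega>)" "k1 \<noteq> k0" "k0 \<noteq> k2"
    and r: "0 < r" "r < m" "r * cos (\<phi> - e) = q * L"
    and r': "0 < r'" "r' < m" "r' * cos (\<phi>' - f) = q' * L"
    and step: "q' = - (q + sin \<phi>)" "\<phi>' = - \<phi> + 2 * f" and c: "0 < L" "0 < q" "0 < q'"
    and ef: "0 < cos e" "0 < cos f"
  shows "((k1, P + complex_of_real r * cis (\<omega> + \<tau> * (pi / 2 + e)), cis (\<omega> + \<tau> * \<phi>)),
          (k2, P' + complex_of_real r' * cis (\<omega> + pi - \<tau> * (pi / 2 + f)), cis (\<omega> + pi - \<tau> * \<phi>'))) \<in> bounce_link v ^^ 2"
proof -
  have s: "sin \<phi> = - (q + q')" using step(1) by simp
  then have neg: "sin \<phi> < 0" using c by simp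
  define t where "t = - (q / sin \<phi>) * L"
  \<comment> \<open>As \<open>sin \<phi> = - (q + q')\<close>, the axis is hit at the fraction
    \<open>q / (q + q')\<close> of its length.\<close>
  have t: "0 < t" "t < L" "t = L - (- (q' / sin \<phi>) * L)"
    using c neg unfolding t_def s by (auto simp: field_simps)
  have c1: "r * sin (pi / 2 + e - \<phi>) = q * L"
    using r(3) sin_add[of "pi / 2" "e - \<phi>"] cos_minus[of "\<phi> - e"] by (simp add: algebra_simps)
  have a1: "0 < sin (pi / 2 + e)" "0 < sin (pi / 2 + f)" using ef by (simp_all add: sin_add)
  have c2: "r' * sin (pi / 2 + f - \<phi>) = q' * L"
    using r'(3) sin_add[of "pi / 2" "f - \<phi>"] unfolding step(2) by (simp add: algebra_simps)
  have 1: "((k1, P + complex_of_real r * cis (\<omega> + \<tau> * (pi / 2 + e)), cis (\<omega> + \<tau> * \<phi>)),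
       (k0, P + complex_of_real t * cis \<omega>, cis (\<omega> - \<tau> * \<phi>))) \<in> bounce_link v"
  proof (rule bounce_linkI[OF rays(1,3,4) r(1,2) t(1,2)])
    show "\<exists>l>0. P + complex_of_real t * cis \<omega> - (P + complex_of_real r * cis (\<omega> + \<tau> * (pi / 2 + e))) =
      complex_of_real l * cis (\<omega> + \<tau> * \<phi>)"
      unfolding t_def by (rule chord_to_axis[OF \<tau> c1 r(1) a1(1) neg])
    show "cis (\<omega> - \<tau> * \<phi>) = (cis \<omega>)\<^sup>2 * cnj (cis (\<omega> + \<tau> * \<phi>))"
      by (simp add: cis_cnj power2_eq_square cis_mult algebra_simps)
  qed
  have 2: "((k0, P + complex_of_real t * cis \<omega>, cis (\<omega> - \<tau> * \<phi>)),
      (k2, P' + complex_of_real r' * cis (\<omega> + pi - \<tau> * (pi / 2 + f)), cis (\<omega> + pi - \<tau> * \<phi>'))) \<in> bounce_link v"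
  proof (rule bounce_linkI[OF rays(3,2,5) t(1,2) r'(1,2)])
    have m\<tau>: "- \<tau> = 1 \<or> - \<tau> = -1" using \<tau> by auto
    have cp: "cis (\<omega> + pi + x) = - cis (\<omega> + x)" for x
      by (simp add: complex_eq_iff cos_add sin_add)
    obtain l where l: "0 < l" "P' + complex_of_real (- (q' / sin \<phi>) * L) * cis (\<omega> + pi)
        - (P' + complex_of_real r' * cis (\<omega> + pi + - \<tau> * (pi / 2 + f))) = complex_of_real l * cis (\<omega> + pi + - \<tau> * \<phi>)"
      using chord_to_axis[OF m\<tau> c2 r'(1) a1(2) neg] by blast
    have "P + complex_of_real t * cis \<omega> = P' + complex_of_real (- (q' / sin \<phi>) * L) * cis (\<omega> + pi)"
      unfolding P' t(3) using cp[of 0] by (simp add: algebra_simps)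
    moreover have "\<omega> + pi - \<tau> * (pi / 2 + f) = \<omega> + pi + - \<tau> * (pi / 2 + f)" by simp
    ultimately have "P' + complex_of_real r' * cis (\<omega> + pi - \<tau> * (pi / 2 + f)) - (P + complex_of_real t * cis \<omega>)
        = - (complex_of_real l * cis (\<omega> + pi + - \<tau> * \<phi>))"
      using l(2) by (metis minus_diff_eq)
    also have "\<dots> = complex_of_real l * cis (\<omega> - \<tau> * \<phi>)" unfolding cp by simp
    finally show "\<exists>l>0. P' + complex_of_real r' * cis (\<omega> + pi - \<tau> * (pi / 2 + f)) - (P + complex_of_real t * cis \<omega>)
      = complex_of_real l * cis (\<omega> - \<tau> * \<phi>)" using l(1) by blast
    have "cis (\<omega> + pi - \<tau> * \<phi>') = cis (2 * (\<omega> + pi - \<tau> * (pi / 2 + f)) - (\<omega> - \<tau> * \<phi>))"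
      unfolding step(2) using \<tau>
      by (auto simp: complex_eq_iff cos_add sin_add cos_diff sin_diff algebra_simps)
    also have "\<dots> = (cis (\<omega> + pi - \<tau> * (pi / 2 + f)))\<^sup>2 * cnj (cis (\<omega> - \<tau> * \<phi>))"
      by (simp add: cis_cnj power2_eq_square cis_mult algebra_simps)
    finally show "cis (\<omega> + pi - \<tau> * \<phi>') = (cis (\<omega> + pi - \<tau> * (pi / 2 + f)))\<^sup>2 * cnj (cis (\<omega> - \<tau> * \<phi>))" .
  qed
  from 1 2 show ?thesis by (auto simp: numeral_2_eq_2)
qed

section \<open>Periodic paths near a rectangle\<close>

lemma abs_sin_diff_le: "\<bar>sin x - sin y\<bar> \<le> \<bar>x - y\<bar>" for x y :: real
proof -
  have "\<bar>sin x - sin y\<bar> = 2 * \<bar>sin ((x - y) / 2)\<bar> * \<bar>cos ((x + y) / 2)\<bar>"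
    by (simp add: sin_diff_sin abs_mult)
  also have "\<dots> \<le> 2 * \<bar>(x - y) / 2\<bar> * 1"
    by (intro mult_mono abs_sin_x_le_abs_x) auto
  finally show ?thesis by simp
qed

lemma abs_cos_diff_le: "\<bar>cos x - cos y\<bar> \<le> \<bar>x - y\<bar>" for x y :: real
  using abs_sin_diff_le[of "pi / 2 - x" "pi / 2 - y"] by (simp add: sin_diff)

text \<open>With \<open>s\<close> the sine of the angle between path and side,
  \<open>q * L / s\<close> is the distance from the vertex at which the side is hit. One factor
  \<open>m\<close> in the bound on \<open>q\<close> pays for \<open>s\<close> being as small as
  \<open>m / 20\<close>, the other for sides as short as \<open>m\<close>.\<close>

lemma hit_radius:
  fixes q s b :: real
  assumes "0 < q * s" "\<bar>q\<bar> \<le> m\<^sup>2 / 100" "m / 20 \<le> \<bar>s\<bar>" "0 < L" "L \<le> 4" "0 < m" "m \<le> 1"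
  shows "0 < q * L / s" "q * L / s < m" "q * L / s \<le> L / 4" "q * L / s * s = q * L"
proof -
  have s: "s \<noteq> 0" "q / s = \<bar>q\<bar> / \<bar>s\<bar>" using assms(1) by (auto simp: zero_less_mult_iff)
  have "\<bar>q\<bar> / \<bar>s\<bar> \<le> (m\<^sup>2 / 100) / (m / 20)" using assms by (intro frac_le) auto
  also have "\<dots> = m / 5" using assms by (simp add: power2_eq_square)
  finally have 1: "q / s \<le> m / 5" using s by simp
  have 2: "0 < q / s" using assms(1) by (auto simp: zero_less_mult_iff zero_less_divide_iff)
  have e: "q * L / s = q / s * L" by simp
  show "0 < q * L / s" unfolding e by (rule mult_pos_pos[OF 2 assms(4)])
  have "q / s * L \<le> m / 5 * 4" using 1 2 assms by (intro mult_mono) auto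
  then show "q * L / s < m" unfolding e using assms(6) by linarith
  have "q / s * L \<le> 1 / 4 * L" using 1 assms by (intro mult_right_mono) auto
  then show "q * L / s \<le> L / 4" unfolding e by simp
  show "q * L / s * s = q * L" using s by simp
qed

text \<open>Applied to kick steps, each of which is one or two bounces: a cycle of at most 16 kicks
  becomes one of at most 32 bounces.\<close>

lemma relpow_map_bounded:
  assumes "(a, b) \<in> R ^^ n" "\<And>x y. (x, y) \<in> R \<Longrightarrow> \<exists>k\<in>{1, 2}. (g x, g y) \<in> S ^^ k"
  shows "\<exists>k. n \<le> k \<and> k \<le> 2 * n \<and> (g a, g b) \<in> S ^^ k"
  using assms(1)
proof (induction n arbitrary: b)
  case (Suc n)
  then obtain c where c: "(a, c) \<in> R ^^ n" "(c, b) \<in> R" by auto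
  from Suc.IH[OF c(1)] obtain k where k: "n \<le> k" "k \<le> 2 * n" "(g a, g c) \<in> S ^^ k" by blast
  from assms(2)[OF c(2)] obtain i where i: "i \<in> {1, 2}" "(g c, g b) \<in> S ^^ i" by blast
  have "(g a, g b) \<in> S ^^ (k + i)" using k(3) i(2) by (auto simp: relpow_add)
  then show ?case using k i by (intro exI[of _ "k + i"]) auto
qed auto

text \<open>Here \<open>q\<close> and \<open>\<phi>\<close> belong to the unfolded path. For
  negative \<open>q\<close> it runs behind the side and is folded back by changing both
  signs.\<close>

definition side_state :: "nat \<Rightarrow> complex \<Rightarrow> real \<Rightarrow> real \<Rightarrow> real \<Rightarrow> real \<Rightarrow> real \<times> real \<Rightarrow> nat \<times> complex \<times> complex" where
  "side_state k P \<omega> \<tau> f L = (\<lambda>(q, \<phi>). (k,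
     P + complex_of_real (\<bar>q\<bar> * L / cos (sgn q * \<phi> - f)) * cis (\<omega> + \<tau> * (pi / 2 + f)),
     cis (\<omega> + \<tau> * (sgn q * \<phi>))))"

lemma side_state_step:
  assumes P': "P' = P + complex_of_real L * cis \<omega>" and \<tau>: "\<tau> = 1 \<or> \<tau> = -1"
    and rays: "ray v m k1 P (cis (\<omega> + \<tau> * (pi / 2 + e)))" "ray v m k2 P' (cis (\<omega> + pi - \<tau> * (pi / 2 + f)))"
      "ray v L k0 P (cis \<omega>)" "k1 \<noteq> k0" "k0 \<noteq> k2" "k1 \<noteq> k2"
    and m: "0 < m" "m \<le> 1" and L: "0 < L" "L \<le> 4" and ef: "\<bar>e\<bar> \<le> 1 / 10" "\<bar>f\<bar> \<le> 1 / 10"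
    and nz: "q \<noteq> 0" "q' \<noteq> 0" and b: "\<bar>q\<bar> \<le> m\<^sup>2 / 100" "\<bar>q'\<bar> \<le> m\<^sup>2 / 100" "\<bar>\<phi>\<bar> \<le> m\<^sup>2 / 100" "\<bar>\<phi>'\<bar> \<le> m\<^sup>2 / 100"
    and step: "q' = q + sin \<phi>" "\<phi>' = \<phi> + 2 * sgn q' * f"
  shows "\<exists>n\<in>{1, 2}. (side_state k1 P \<omega> \<tau> e L (q, \<phi>), side_state k2 P' (\<omega> + pi) (- \<tau>) f L (q', \<phi>')) \<in> bounce_link v ^^ n"
proof -
  define p1 where "p1 = sgn q * \<phi>"
  define p2 where "p2 = sgn q' * \<phi>'"
  have m2: "m\<^sup>2 \<le> 1" using m by (simp add: power2_eq_square mult_le_one)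
  have p: "\<bar>p1\<bar> \<le> 1 / 100" "\<bar>p2\<bar> \<le> 1 / 100"
    using b(3,4) nz m2 unfolding p1_def p2_def abs_mult by (simp_all add: abs_sgn_eq)
  have half: "1 / 2 < cos x" if "\<bar>x\<bar> \<le> 1 / 5" for x :: real
    using abs_cos_diff_le[of x 0] that by simp
  have c: "1 / 2 < cos (p1 - e)" "1 / 2 < cos (p2 - f)" "1 / 2 < cos p1" "1 / 2 < cos e" "1 / 2 < cos f"
    using p ef by - (rule half, linarith)+
  have h1: "0 < \<bar>q\<bar> * cos (p1 - e)" "\<bar>\<bar>q\<bar>\<bar> \<le> m\<^sup>2 / 100" "m / 20 \<le> \<bar>cos (p1 - e)\<bar>" using c nz b m by auto
  have h2: "0 < \<bar>q'\<bar> * cos (p2 - f)" "\<bar>\<bar>q'\<bar>\<bar> \<le> m\<^sup>2 / 100" "m / 20 \<le> \<bar>cos (p2 - f)\<bar>" using c nz b m by auto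
  note r1 = hit_radius[OF h1 L m]
  note r2 = hit_radius[OF h2 L m]
  have neg: "\<omega> + pi + - \<tau> * x = \<omega> + pi - \<tau> * x" for x by simp
  show ?thesis
  proof (cases "sgn q' = sgn q")
    case True
    have "\<bar>q'\<bar> = \<bar>q\<bar> + sin p1"
      using True nz step(1) unfolding p1_def by (auto simp: sgn_if split: if_splits)
    moreover have "p2 = p1 + 2 * f"
      using True nz unfolding p1_def p2_def step(2) by (auto simp: sgn_if split: if_splits)
    ultimately have "(side_state k1 P \<omega> \<tau> e L (q, \<phi>), side_state k2 P' (\<omega> + pi) (- \<tau>) f L (q', \<phi>')) \<in> bounce_link v"
      using side_step_same[OF P' \<tau> rays(1,2,6) r1 r2 _ _ c(3) L(1)]
      unfolding side_state_def prod.case p1_def[symmetric] p2_def[symmetric] neg by blast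
    then show ?thesis by auto
  next
    case False
    have "\<bar>q'\<bar> = - (\<bar>q\<bar> + sin p1)"
      using False nz step(1) unfolding p1_def by (auto simp: sgn_if split: if_splits)
    moreover have "p2 = - p1 + 2 * f"
      using False nz unfolding p1_def p2_def step(2) by (auto simp: sgn_if split: if_splits)
    moreover have "0 < cos e" "0 < cos f" "0 < \<bar>q\<bar>" "0 < \<bar>q'\<bar>" using c(4,5) nz by linarith+
    ultimately have "(side_state k1 P \<omega> \<tau> e L (q, \<phi>), side_state k2 P' (\<omega> + pi) (- \<tau>) f L (q', \<phi>')) \<in> bounce_link v ^^ 2"
      using side_step_cross[OF P' \<tau> rays(1,2,3,4,5) r1(1,2,4) r2(1,2,4) _ _ L(1)]
      unfolding side_state_def prod.case p1_def[symmetric] p2_def[symmetric] neg by blast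
    then show ?thesis by auto
  qed
qed

text \<open>The vertices run clockwise; \<open>\<theta> i\<close> is the direction of side \<open>i\<close>, unwound to a function on all naturals.
  The interior angle at vertex \<open>i\<close> is \<open>pi/2 + e i\<close>.\<close>

locale near_rectangle =
  fixes v :: "nat \<Rightarrow> complex" and len \<theta> e :: "nat \<Rightarrow> real" and m :: real
  assumes side: "\<And>i. v (Suc i) = v i + complex_of_real (len i) * cis (\<theta> i)"
    and turn: "\<And>i. \<theta> (Suc i) = \<theta> i - pi / 2 + e (Suc i)"
    and period: "\<And>i. v (i + 4) = v i" "\<And>i. \<theta> (i + 4) = \<theta> i - 2 * pi" "\<And>i. e (i + 4) = e i"
    and len: "\<And>i. m \<le> len i" "\<And>i. len i \<le> 2" and m: "0 < m" "m \<le> 1"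
    and small: "\<And>i. \<bar>e i\<bar> \<le> m\<^sup>2 / 2000"
begin

lemma v_mod: "v (k mod 4) = v k" "v (Suc (k mod 4)) = v (Suc k)"
proof -
  have *: "v (k + 4 * n) = v k" for k n
    by (induction n) (simp_all, metis add.assoc add.commute period(1))
  show "v (k mod 4) = v k" using *[of "k mod 4" "k div 4"] by simp
  show "v (Suc (k mod 4)) = v (Suc k)" using *[of "Suc (k mod 4)" "k div 4"] by simp
qed

lemma m2: "m\<^sup>2 \<le> m"
  using m by (simp add: power2_eq_square mult_left_le)

lemma ray_start: "ray v (len j) (j mod 4) (v j) (cis (\<theta> j))"
  using ray_of_side(1)[of v "j mod 4" "len j" "cis (\<theta> j)"] side[of j] len(1)[of j] m by (simp add: v_mod)

lemma ray_end: "ray v (len j) (j mod 4) (v (Suc j)) (- cis (\<theta> j))"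
  using ray_of_side(2)[of v "j mod 4" "len j" "cis (\<theta> j)"] side[of j] len(1)[of j] m by (simp add: v_mod)

text \<open>\<open>j + 3\<close> plays the part of \<open>j - 1\<close>. As the vertices run
  clockwise, the preceding side lies to the right of side \<open>j\<close>, at the interior
  angle.\<close>

lemma ray_before: "ray v (len (j + 3)) ((j + 3) mod 4) (v j) (cis (\<theta> j - pi / 2 - e j))"
proof -
  have "\<theta> (j + 3) = \<theta> (j + 4) + pi / 2 - e j"
    using turn[of "j + 3"] period(3)[of j] by (simp add: algebra_simps eval_nat_numeral)
  then have *: "\<theta> (j + 3) = (\<theta> j - pi / 2 - e j) - pi" using period(2)[of j] by simp
  have "- cis (\<theta> (j + 3)) = cis (\<theta> j - pi / 2 - e j)" unfolding * cis_pi_shift by simp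
  moreover have "v (Suc (j + 3)) = v j" using period(1)[of j] by (simp add: eval_nat_numeral)
  ultimately show ?thesis using ray_end[of "j + 3"] by simp
qed

lemma ray_next: "ray v (len (Suc j)) (Suc j mod 4) (v (Suc j)) (cis (\<theta> j + pi + (pi / 2 + e (Suc j))))"
proof -
  have "cis (\<theta> j + pi + (pi / 2 + e (Suc j))) = cis (\<theta> (Suc j) + 2 * pi)"
    unfolding turn by (simp add: algebra_simps)
  then show ?thesis using ray_start[of "Suc j"] by (simp add: cis_pi_shift)
qed

text \<open>The four turns make up one clockwise revolution, which
  \<open>\<theta> (j + 4) = \<theta> j - 2 * pi\<close> records.\<close>

lemma angle_sum: "e j + e (j + 1) + e (j + 2) + e (j + 3) = 0"
  using turn[of j] turn[of "j + 1"] turn[of "j + 2"] turn[of "j + 3"] period(2,3)[of j]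
  by (simp add: eval_nat_numeral algebra_simps)

section \<open>Paths close to a diagonal\<close>

definition diag_frame :: "nat \<Rightarrow> real \<Rightarrow> real \<Rightarrow> bool" where
  "diag_frame j \<alpha> L \<longleftrightarrow> v (j + 2) = v j + complex_of_real L * cis (\<theta> j - \<alpha>) \<and> 0 < L \<and> L \<le> 4
     \<and> m / 10 \<le> sin \<alpha> \<and> m / 10 \<le> cos \<alpha>"

text \<open>The same diagonal is seen from both of its ends. Reversing it changes the angle
  \<open>\<alpha>\<close> to the adjacent side only by two defects, so the lower bounds on sine and
  cosine survive.\<close>

lemma diag_frame_exists:
  "\<exists>\<alpha> L. diag_frame j \<alpha> L \<and> diag_frame (j + 2) (\<alpha> + e (j + 1) + e (j + 2)) L"
proof -
  define z where "z = complex_of_real (len j) + complex_of_real (len (Suc j)) * cis (- pi / 2 + e (Suc j))"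
  have vz: "v (j + 2) = v j + z * cis (\<theta> j)"
    using side[of j] side[of "Suc j"] turn[of j] unfolding z_def
    by (simp add: algebra_simps cis_mult)
  have re: "Re z = len j + len (Suc j) * sin (e (Suc j))" and im: "Im z = - len (Suc j) * cos (e (Suc j))"
    unfolding z_def by (simp_all add: cos_diff sin_diff cos_add sin_add)
  have e1: "\<bar>e (Suc j)\<bar> \<le> m / 2000" using small[of "Suc j"] m2 by linarith
  have lp: "0 < len (Suc j)" "0 < len j" using len(1)[of "Suc j"] len(1)[of j] m by linarith+
  have "\<bar>sin (e (Suc j))\<bar> \<le> m / 2000" using abs_sin_x_le_abs_x[of "e (Suc j)"] e1 by linarith
  then have "\<bar>len (Suc j) * sin (e (Suc j))\<bar> \<le> 2 * (m / 2000)"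
    unfolding abs_mult using lp len(2)[of "Suc j"] by (intro mult_mono) auto
  then have re': "9 / 10 * m \<le> Re z" unfolding re using len(1)[of j] m by linarith
  have "9 / 10 \<le> cos (e (Suc j))" using abs_cos_diff_le[of "e (Suc j)" 0] e1 m by simp
  then have "m * (9 / 10) \<le> len (Suc j) * cos (e (Suc j))" using len(1)[of "Suc j"] m by (intro mult_mono) auto
  then have im': "9 / 10 * m \<le> - Im z" unfolding im by simp
  define L where "L = cmod z"
  have L: "0 < L" using re' m unfolding L_def by (metis complex_Re_le_cmod dual_order.strict_trans2 less_eq_real_def mult_pos_pos order.trans zero_less_divide_iff zero_less_numeral linorder_not_less)
  have "L \<le> cmod (complex_of_real (len j)) + cmod (complex_of_real (len (Suc j)) * cis (- pi / 2 + e (Suc j)))"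
    unfolding L_def z_def by (rule norm_triangle_ineq)
  then have L4: "L \<le> 4" using lp len(2)[of j] len(2)[of "Suc j"] by (simp add: norm_mult)
  define \<alpha> where "\<alpha> = - Arg z"
  have za: "z = complex_of_real L * cis (- \<alpha>)"
    using rcis_cmod_Arg[of z] unfolding L_def \<alpha>_def rcis_def by simp
  have "Re z = L * cos \<alpha>" "- Im z = L * sin \<alpha>" using za by simp_all
  then have ca: "9 / 10 * m \<le> L * cos \<alpha>" and sa: "9 / 10 * m \<le> L * sin \<alpha>" using re' im' by simp_all
  \<comment> \<open>\<open>L \<le> 4\<close> yields \<open>m / 5\<close>, twice what is wanted; the
    slack pays for passing from \<open>\<alpha>\<close> to \<open>\<alpha>'\<close>.\<close>
  have bound: "m / 5 \<le> x" if "9 / 10 * m \<le> L * x" for x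
  proof -
    have "0 < L * x" using that m by (smt (verit) zero_less_divide_iff mult_pos_pos)
    then have "0 < x" using L by (simp add: zero_less_mult_iff)
    then have "L * x \<le> 4 * x" using L4 by simp
    then show ?thesis using that m by linarith
  qed
  define \<alpha>' where "\<alpha>' = \<alpha> + e (j + 1) + e (j + 2)"
  have d: "\<bar>\<alpha>' - \<alpha>\<bar> \<le> m / 1000" using small[of "j + 1"] small[of "j + 2"] m2 unfolding \<alpha>'_def by linarith
  have a': "m / 10 \<le> sin \<alpha>'" "m / 10 \<le> cos \<alpha>'"
    using bound[OF sa] bound[OF ca] abs_sin_diff_le[of \<alpha>' \<alpha>] abs_cos_diff_le[of \<alpha>' \<alpha>] d m by linarith+
  have vj: "v (j + 2) = v j + complex_of_real L * cis (\<theta> j - \<alpha>)"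
    unfolding vz za by (simp add: cis_mult algebra_simps)
  have "\<theta> (j + 2) - \<alpha>' = \<theta> j - \<alpha> - pi"
    using turn[of j] turn[of "Suc j"] unfolding \<alpha>'_def by simp
  then have "cis (\<theta> (j + 2) - \<alpha>') = - cis (\<theta> j - \<alpha>)" by (simp add: cis_pi_shift)
  then have "v (j + 2 + 2) = v (j + 2) + complex_of_real L * cis (\<theta> (j + 2) - \<alpha>')"
    using vj period(1)[of j] by (simp add: eval_nat_numeral)
  then have "diag_frame j \<alpha> L \<and> diag_frame (j + 2) \<alpha>' L"
    unfolding diag_frame_def using vj L L4 a' bound[OF sa] bound[OF ca] m by auto
  then show ?thesis unfolding \<alpha>'_def by blast
qed

text \<open>The angle from the diagonal at vertex \<open>j\<close> to the side that the path leaves: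
  side \<open>j\<close> for \<open>q > 0\<close> (\<open>s\<close> true), the preceding side for
  \<open>q < 0\<close>.\<close>

definition corner_ray :: "nat \<Rightarrow> real \<Rightarrow> bool \<Rightarrow> real" where
  "corner_ray j \<alpha> s = (if s then \<alpha> else \<alpha> - pi / 2 - e j)"

definition diag_state :: "nat \<Rightarrow> real \<Rightarrow> real \<Rightarrow> real \<times> real \<Rightarrow> nat \<times> complex \<times> complex" where
  "diag_state j \<alpha> L = (\<lambda>(q, \<phi>). let A = corner_ray j \<alpha> (0 < q) in
     ((if 0 < q then j else j + 3) mod 4,
      v j + complex_of_real (q * L / sin (A - \<phi>)) * cis (\<theta> j - \<alpha> + A), cis (\<theta> j - \<alpha> + \<phi>)))"

lemma corner_ray: "ray v m ((if s then j else j + 3) mod 4) (v j) (cis (\<theta> j - \<alpha> + corner_ray j \<alpha> s))"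
  using ray_mono[OF ray_start[of j] len(1)] ray_mono[OF ray_before[of j] len(1)]
  by (cases s) (simp_all add: corner_ray_def algebra_simps)

lemma corner_ray_sin:
  assumes F: "diag_frame j \<alpha> L" and \<phi>: "\<bar>\<phi>\<bar> \<le> m\<^sup>2 / 100"
  shows "m / 20 \<le> sin (corner_ray j \<alpha> True - \<phi>)" "sin (corner_ray j \<alpha> False - \<phi>) \<le> - (m / 20)"
proof -
  have \<phi>': "\<bar>\<phi>\<bar> \<le> m / 100" using \<phi> m2 by linarith
  have e': "\<bar>e j\<bar> \<le> m / 2000" using small[of j] m2 by linarith
  show "m / 20 \<le> sin (corner_ray j \<alpha> True - \<phi>)"
    using abs_sin_diff_le[of "\<alpha> - \<phi>" \<alpha>] F \<phi>' m unfolding diag_frame_def corner_ray_def by (simp only: if_True) linarith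
  have "sin (corner_ray j \<alpha> False - \<phi>) = - cos (\<alpha> - e j - \<phi>)"
    using sin_diff[of "\<alpha> - e j - \<phi>" "pi / 2"] unfolding corner_ray_def by (simp add: algebra_simps)
  moreover have "m / 20 \<le> cos (\<alpha> - e j - \<phi>)"
    using abs_cos_diff_le[of "\<alpha> - e j - \<phi>" \<alpha>] F \<phi>' e' m unfolding diag_frame_def by linarith
  ultimately show "sin (corner_ray j \<alpha> False - \<phi>) \<le> - (m / 20)" by simp
qed

lemma cos_gt_half: "\<bar>\<phi>\<bar> \<le> m\<^sup>2 / 100 \<Longrightarrow> 1 / 2 < cos \<phi>"
  using abs_cos_diff_le[of \<phi> 0] m m2 by simp

lemma diag_state_step:
  assumes F: "diag_frame j \<alpha> L" and F': "diag_frame (j + 2) \<alpha>' L" and \<alpha>': "\<alpha>' = \<alpha> + e (j + 1) + e (j + 2)"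
    and nz: "q \<noteq> 0" "q' \<noteq> 0" and b: "\<bar>q\<bar> \<le> m\<^sup>2 / 100" "\<bar>q'\<bar> \<le> m\<^sup>2 / 100" "\<bar>\<phi>\<bar> \<le> m\<^sup>2 / 100" "\<bar>\<phi>'\<bar> \<le> m\<^sup>2 / 100"
    and step: "q' = q + sin \<phi>" "\<phi>' = \<phi> + 2 * sgn q' * e (j + 2)"
  shows "(diag_state j \<alpha> L (q, \<phi>), diag_state (j + 2) \<alpha>' L (q', \<phi>')) \<in> bounce_link v ^^ 2"
proof -
  define \<omega> where "\<omega> = \<theta> j - \<alpha>"
  have \<omega>': "\<theta> (j + 2) - \<alpha>' = \<omega> - pi"
    using turn[of j] turn[of "Suc j"] unfolding \<alpha>' \<omega>_def by simp
  have cw: "cis (\<theta> (j + 2) - \<alpha>' + x) = cis (\<omega> + pi + x)" for x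
    unfolding \<omega>' using cis_pi_shift(3)[of "\<omega> - pi + x"] by (simp add: algebra_simps)
  define A where "A = corner_ray j \<alpha> (0 < q)"
  define A' where "A' = corner_ray (j + 2) \<alpha>' (0 < q')"
  \<comment> \<open>At the far vertex the path first hits the side that it does not leave from.
    \<open>B\<close> is measured in the opposite sense, hence the minus sign.\<close>
  define B where "B = - corner_ray (j + 2) \<alpha>' (\<not> 0 < q')"
  have L: "0 < L" "L \<le> 4" using F by (auto simp: diag_frame_def)
  note s1 = corner_ray_sin[OF F b(3)]
  note s2 = corner_ray_sin[OF F' b(4)]
  note s3 = corner_ray_sin[OF F' b(3)]
  have sB: "sin (B + \<phi>) = - sin (corner_ray (j + 2) \<alpha>' (\<not> 0 < q') - \<phi>)"
    unfolding B_def using sin_minus[of "corner_ray (j + 2) \<alpha>' (\<not> 0 < q') - \<phi>"] by (simp add: algebra_simps)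
  \<comment> \<open>By \<open>corner_ray_sin\<close> each sine has the sign of the position it is
    paired with, so all three hit radii are positive.\<close>
  have h1: "0 < q * sin (A - \<phi>)" "m / 20 \<le> \<bar>sin (A - \<phi>)\<bar>"
    using s1 nz(1) m unfolding A_def by (cases "0 < q"; simp add: zero_less_mult_iff)+
  have h2: "0 < q' * sin (A' - \<phi>')" "m / 20 \<le> \<bar>sin (A' - \<phi>')\<bar>"
    using s2 nz(2) m unfolding A'_def by (cases "0 < q'"; simp add: zero_less_mult_iff)+
  have h3: "0 < q' * sin (B + \<phi>)" "m / 20 \<le> \<bar>sin (B + \<phi>)\<bar>"
    using s3 nz(2) m unfolding sB by (cases "0 < q'"; simp add: zero_less_mult_iff mult_less_0_iff)+
  note r1 = hit_radius[OF h1(1) b(1) h1(2) L m]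
  note r2 = hit_radius[OF h2(1) b(2) h2(2) L m]
  note r3 = hit_radius[OF h3(1) b(2) h3(2) L m]
  have P': "v (j + 2) = v j + complex_of_real L * cis \<omega>" using F by (simp add: diag_frame_def \<omega>_def)
  have ray1: "ray v m ((if 0 < q then j else j + 3) mod 4) (v j) (cis (\<omega> + A))"
    using corner_ray[of "0 < q" j \<alpha>] by (simp add: \<omega>_def A_def)
  have ray2: "ray v m ((if \<not> 0 < q' then j + 2 else j + 2 + 3) mod 4) (v (j + 2)) (cis (\<omega> + pi - B))"
    using corner_ray[of "\<not> 0 < q'" "j + 2" \<alpha>'] cw[of "- B"] unfolding B_def by (simp del: add_2_eq_Suc')
  have ray3: "ray v m ((if 0 < q' then j + 2 else j + 2 + 3) mod 4) (v (j + 2)) (cis (\<omega> + pi + A'))"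
    using corner_ray[of "0 < q'" "j + 2" \<alpha>'] cw[of A'] unfolding A'_def by (simp del: add_2_eq_Suc')
  have ne: "(if 0 < q then j else j + 3) mod 4 \<noteq> (if \<not> 0 < q' then j + 2 else j + 2 + 3) mod 4"
    "(if \<not> 0 < q' then j + 2 else j + 2 + 3) mod 4 \<noteq> (if 0 < q' then j + 2 else j + 2 + 3) mod 4"
    by (auto; presburger)+
  have \<sigma>: "sgn q' = 1 \<or> sgn q' = - 1" "0 < sgn q' * q'" using nz(2) by (auto simp: sgn_if)
  have AB: "A' + B = sgn q' * (pi / 2 + e (j + 2))"
    unfolding A'_def B_def corner_ray_def using nz(2) by (auto simp: sgn_if)
  have f: "\<bar>e (j + 2)\<bar> < 1" using small[of "j + 2"] m m2 by linarith
  show ?thesis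
    using diagonal_step[OF P' ray1 ray2 ray3 ne \<sigma> AB f r1(1,2,3,4) r3(1,2,3,4) r2(1,2,4) step cos_gt_half[OF b(3)] L(1)]
    unfolding diag_state_def Let_def prod.case A_def[symmetric] A'_def[symmetric] \<omega>_def[symmetric] cw .
qed

lemma cis_theta_shift: "cis (\<theta> (j + 4) - \<alpha> + x) = cis (\<theta> j - \<alpha> + x)"
proof -
  have "\<theta> (j + 4) - \<alpha> + x = (\<theta> j - \<alpha> + x) - 2 * pi" by (simp add: period(2))
  then show ?thesis by (simp only: cis_pi_shift)
qed

lemma diag_frame_shift: "diag_frame (j + 4) \<alpha> L = diag_frame j \<alpha> L"
proof -
  have "v (j + 4 + 2) = v (j + 2)" using period(1)[of "j + 2"] by (metis add.assoc add.commute)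
  then show ?thesis
    using cis_theta_shift[of j \<alpha> 0] by (simp only: diag_frame_def period(1) add_0_right)
qed

lemma diag_state_shift: "diag_state (j + 4) \<alpha> L p = diag_state j \<alpha> L p"
proof -
  have md: "(if s then j + 4 else j + 4 + 3) mod 4 = (if s then j else j + 3) mod 4" for s by (cases s; simp; presburger?)
  have "corner_ray (j + 4) = corner_ray j" by (simp add: fun_eq_iff corner_ray_def period)
  then show ?thesis
    by (simp only: diag_state_def Let_def cis_theta_shift period(1) md)
qed

section \<open>Cycles of bounces along a diagonal, along a side and in a rectangle\<close>

lemma diag_cycle:
  assumes "kick_cycle (e j) (e (j + 2)) (m\<^sup>2 / 100)"
  shows "\<exists>S n. 0 < n \<and> n \<le> 32 \<and> (S, S) \<in> bounce_link v ^^ n"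
proof -
  obtain \<alpha> L where F: "diag_frame j \<alpha> L" and F': "diag_frame (j + 2) (\<alpha> + e (j + 1) + e (j + 2)) L"
    using diag_frame_exists by blast
  define \<alpha>' where "\<alpha>' = \<alpha> + e (j + 1) + e (j + 2)"
  \<comment> \<open>The way back ends at vertex \<open>j + 4\<close>, which is \<open>j\<close>
    again; its frame is the original one because the defects sum to 0.\<close>
  have \<alpha>: "\<alpha> = \<alpha>' + e (j + 2 + 1) + e (j + 2 + 2)"
    using angle_sum[of j] period(3)[of j] unfolding \<alpha>'_def by (simp add: eval_nat_numeral)
  have F'': "diag_frame (j + 2 + 2) \<alpha> L" using F diag_frame_shift[of j] by (simp add: eval_nat_numeral)
  define g where "g = (\<lambda>(c, p). if c then diag_state j \<alpha> L p else diag_state (j + 2) \<alpha>' L p)"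
  obtain S n where n: "0 < n" "n \<le> 16" "(S, S) \<in> kick_step (e j) (e (j + 2)) (m\<^sup>2 / 100) ^^ n"
    using assms unfolding kick_cycle_def by blast
  have "(g x, g y) \<in> bounce_link v ^^ 2" if xy: "(x, y) \<in> kick_step (e j) (e (j + 2)) (m\<^sup>2 / 100)" for x y
  proof -
    obtain c q \<phi> where x: "x = (c, q, \<phi>)" by (cases x)
    obtain c' q' \<phi>' where y: "y = (c', q', \<phi>')" by (cases y)
    note h = kick_stepD[OF xy[unfolded x y]]
    show ?thesis
    proof (cases c)
      case True
      then show ?thesis
        using diag_state_step[OF F F'[folded \<alpha>'_def] \<alpha>'_def h(1-7)] h(8,9) unfolding x y g_def by simp
    next
      case False
      have "diag_state (j + 2 + 2) \<alpha> L (q', \<phi>') = diag_state j \<alpha> L (q', \<phi>')"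
        using diag_state_shift[of j \<alpha> L] by (simp add: eval_nat_numeral)
      moreover have "e (j + 2 + 2) = e j" using period(3)[of j] by (simp add: eval_nat_numeral)
      ultimately show ?thesis
        using diag_state_step[OF F'[folded \<alpha>'_def] F'' \<alpha> h(1-7)] False h(8,9) unfolding x y g_def by simp
    qed
  qed
  from relpow_map_bounded[OF n(3), of g "bounce_link v"] this
  obtain k where "n \<le> k" "k \<le> 2 * n" "(g S, g S) \<in> bounce_link v ^^ k" by blast
  then show ?thesis using n by (intro exI[of _ "g S"] exI[of _ k]) auto
qed

lemma side_cycle:
  assumes "kick_cycle (e j) (e (Suc j)) (m\<^sup>2 / 100)"
  shows "\<exists>S n. 0 < n \<and> n \<le> 32 \<and> (S, S) \<in> bounce_link v ^^ n"
proof -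
  define L where "L = len j"
  have L: "0 < L" "L \<le> 4" using len(1)[of j] len(2)[of j] m unfolding L_def by linarith+
  have ef: "\<bar>e j\<bar> \<le> 1 / 10" "\<bar>e (Suc j)\<bar> \<le> 1 / 10" using small[of j] small[of "Suc j"] m2 m by linarith+
  have k: "(j + 3) mod 4 \<noteq> j mod 4" "j mod 4 \<noteq> Suc j mod 4" "(j + 3) mod 4 \<noteq> Suc j mod 4" by presburger+
  \<comment> \<open>\<open>\<tau> = -1\<close> on the way out: the vertices run clockwise, so the
    interior is to the right of side \<open>j\<close>. On the way back it is to the left.\<close>
  have ray1: "ray v m ((j + 3) mod 4) (v j) (cis (\<theta> j + -1 * (pi / 2 + e j)))"
    using ray_mono[OF ray_before[of j] len(1)] by (simp add: algebra_simps)
  have ray2: "ray v m (Suc j mod 4) (v (Suc j)) (cis (\<theta> j + pi + 1 * (pi / 2 + e (Suc j))))"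
    using ray_mono[OF ray_next[of j] len(1)] by simp
  have ray0: "ray v L (j mod 4) (v j) (cis (\<theta> j))" "ray v L (j mod 4) (v (Suc j)) (cis (\<theta> j + pi))"
    using ray_start[of j] ray_end[of j] unfolding L_def cis_pi_shift by simp_all
  have P1: "v (Suc j) = v j + complex_of_real L * cis (\<theta> j)" using side[of j] by (simp add: L_def)
  then have P2: "v j = v (Suc j) + complex_of_real L * cis (\<theta> j + pi)" by (simp add: cis_pi_shift)
  have per: "cis (\<theta> j + pi + pi + x) = cis (\<theta> j + x)" for x
    using cis_pi_shift(3)[of "\<theta> j + x"] by (simp add: algebra_simps)
  have ray1': "ray v m ((j + 3) mod 4) (v j) (cis (\<theta> j + pi + pi - 1 * (pi / 2 + e j)))"
    using ray1 per[of "- (pi / 2 + e j)"] by (simp add: algebra_simps)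
  have ray2': "ray v m (Suc j mod 4) (v (Suc j)) (cis (\<theta> j + pi - -1 * (pi / 2 + e (Suc j))))"
    using ray2 by simp
  define g where "g = (\<lambda>(c, p). if c then side_state ((j + 3) mod 4) (v j) (\<theta> j) (- 1) (e j) L p
     else side_state (Suc j mod 4) (v (Suc j)) (\<theta> j + pi) 1 (e (Suc j)) L p)"
  obtain S n where n: "0 < n" "n \<le> 16" "(S, S) \<in> kick_step (e j) (e (Suc j)) (m\<^sup>2 / 100) ^^ n"
    using assms unfolding kick_cycle_def by blast
  have "\<exists>k\<in>{1, 2}. (g x, g y) \<in> bounce_link v ^^ k" if xy: "(x, y) \<in> kick_step (e j) (e (Suc j)) (m\<^sup>2 / 100)" for x y
  proof -
    obtain c q \<phi> where x: "x = (c, q, \<phi>)" by (cases x)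
    obtain c' q' \<phi>' where y: "y = (c', q', \<phi>')" by (cases y)
    note h = kick_stepD[OF xy[unfolded x y]]
    show ?thesis
    proof (cases c)
      case True
      with h(8) have "\<phi>' = \<phi> + 2 * sgn q' * e (Suc j)" by simp
      from side_state_step[OF P1 _ ray1 ray2' ray0(1) k m L ef h(1-7) this] True h(9)
      show ?thesis unfolding x y g_def by simp
    next
      case False
      have st: "side_state k P (\<theta> j + pi + pi) \<tau> f L p = side_state k P (\<theta> j) \<tau> f L p" for k P \<tau> f p
        unfolding side_state_def per ..
      from False h(8) have "\<phi>' = \<phi> + 2 * sgn q' * e j" by simp
      from side_state_step[OF P2 _ ray2 ray1' ray0(2) k(2)[symmetric] k(1)[symmetric] k(3)[symmetric] m L ef(2,1) h(1-7) this] False h(9)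
      show ?thesis unfolding x y g_def st by simp
    qed
  qed
  from relpow_map_bounded[OF n(3), of g "bounce_link v"] this
  obtain k where "n \<le> k" "k \<le> 2 * n" "(g S, g S) \<in> bounce_link v ^^ k" by blast
  then show ?thesis using n by (intro exI[of _ "g S"] exI[of _ k]) auto
qed

text \<open>A chord perpendicular to the opposite sides 0 and 2 is run back and forth; its feet are
  taken at distance \<open>m / 2\<close> from \<open>v 1\<close> and \<open>v 2\<close>.\<close>

lemma rectangle_cycle:
  assumes "\<And>i. i < 4 \<Longrightarrow> e i = 0"
  shows "\<exists>S n. 0 < n \<and> n \<le> 32 \<and> (S, S) \<in> bounce_link v ^^ n"
proof -
  have \<theta>: "\<theta> (Suc 0) = \<theta> 0 - pi / 2" "\<theta> 2 = \<theta> 0 - pi"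
    using turn[of 0] turn[of 1] assms[of 1] assms[of 2] by (simp_all add: numeral_2_eq_2)
  have c: "cis (\<theta> 2) = - cis (\<theta> 0)" unfolding \<theta> cis_pi_shift ..
  define u where "u = cis (\<theta> (Suc 0))"
  have u2: "(cis (\<theta> 0))\<^sup>2 * cnj u = - u" "(cis (\<theta> 0))\<^sup>2 * cnj (- u) = u"
    unfolding u_def \<theta> by (simp_all add: cis_cnj power2_eq_square cis_mult complex_eq_iff cos_add sin_add cos_diff sin_diff)
  have r0: "ray v m 0 (v (Suc 0)) (- cis (\<theta> 0))" using ray_mono[OF ray_end[of 0] len(1)] by simp
  have r2: "ray v m 2 (v 2) (- cis (\<theta> 0))" using ray_mono[OF ray_start[of 2] len(1)] c by simp
  define p0 where "p0 = v (Suc 0) + complex_of_real (m / 2) * - cis (\<theta> 0)"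
  define p2 where "p2 = v 2 + complex_of_real (m / 2) * - cis (\<theta> 0)"
  have d: "p2 - p0 = complex_of_real (len 1) * u" using side[of 1] unfolding p0_def p2_def u_def
    by (simp add: numeral_2_eq_2)
  have l: "0 < len 1" using len(1)[of 1] m by linarith
  have 1: "((0, p0, u), (2, p2, - u)) \<in> bounce_link v"
    unfolding p0_def p2_def
    by (rule bounce_linkI[OF r0 r2]) (use m d l u2 in \<open>auto simp: p0_def p2_def\<close>)
  have 2: "((2, p2, - u), (0, p0, u)) \<in> bounce_link v"
    unfolding p0_def p2_def
  proof (rule bounce_linkI[OF r2 r0])
    have "p0 - p2 = complex_of_real (len 1) * - u" using d by (simp add: algebra_simps)
    then show "\<exists>l>0. v (Suc 0) + complex_of_real (m / 2) * - cis (\<theta> 0) - (v 2 + complex_of_real (m / 2) * - cis (\<theta> 0)) =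
        complex_of_real l * - u"
      using l unfolding p0_def p2_def by blast
  qed (use m u2 in auto)
  have "((0, p0, u), (0, p0, u)) \<in> bounce_link v ^^ Suc (Suc 0)" using 1 2 by auto
  then show ?thesis by (intro exI[of _ "(0, p0, u)"] exI[of _ "Suc (Suc 0)"]) simp
qed

lemma bounce_cycle:
  "\<exists>S n. 0 < n \<and> n \<le> 32 \<and> (S, S) \<in> bounce_link v ^^ n"
proof (cases "\<exists>i<4. e i \<noteq> 0")
  case False
  then show ?thesis using rectangle_cycle by blast
next
  case True
  have b: "\<bar>e i\<bar> \<le> m\<^sup>2 / 100 / 20" for i using small[of i] by simp
  have "m\<^sup>2 / 100 \<le> 1" using m2 m by linarith
  moreover have "e 0 + e 1 + e 2 + e 3 = 0" using angle_sum[of 0] by (simp add: numeral_2_eq_2 numeral_3_eq_3)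
  ultimately obtain i j where ij: "i < j" "j < 4" "kick_cycle (e i) (e j) (m\<^sup>2 / 100)"
    using kick_cycle_pair[of e "m\<^sup>2 / 100"] b True by blast
  \<comment> \<open>The two vertices are consecutive or opposite, or they are 0 and 3, which side 3
    joins in the other order.\<close>
  have "j = Suc i \<or> j = i + 2 \<or> (i = 0 \<and> j = 3)" using ij by presburger
  then show ?thesis
  proof (elim disjE)
    assume "i = 0 \<and> j = 3"
    moreover have "e (Suc 3) = e 0" using period(3)[of 0] by (simp add: eval_nat_numeral)
    ultimately show ?thesis using side_cycle[of 3] kick_cycle_commute[OF ij(3)] by simp
  qed (use ij side_cycle diag_cycle in auto)
qed

end

section \<open>From cycles of bounces to billiard paths: convexity\<close>

lemma cycle_function:
  assumes "(S, S) \<in> R ^^ n" "0 < n"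
  shows "\<exists>f. (\<forall>k. (f k, f (Suc k)) \<in> R) \<and> (\<forall>k. f (k + n) = f k)"
proof -
  obtain g where g: "g 0 = S" "g n = S" "\<And>i. i < n \<Longrightarrow> (g i, g (Suc i)) \<in> R"
    using assms(1) unfolding relpow_fun_conv by blast
  have "(g (k mod n), g (Suc k mod n)) \<in> R" for k
    using g(1,2) g(3)[of "k mod n"] assms(2) by (auto simp: mod_Suc)
  then show ?thesis by (intro exI[of _ "\<lambda>k. g (k mod n)"]) auto
qed

text \<open>Barycentric coordinates: \<open>p\<close> is the ratio of \<open>y\<close> to the height
  \<open>sin a * sin b / sin (a + b)\<close> over the unit base; the side inequalities make the
  other two nonnegative.\<close>

lemma in_convex_hull_triangle:
  fixes \<sigma> :: real
  assumes ab: "0 < a" "0 < b" "a + b < pi" and y: "0 \<le> y"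
    and l: "y * cos a \<le> x * sin a" and r: "y * cos b \<le> (1 - x) * sin b" and \<sigma>: "\<sigma> = 1 \<or> \<sigma> = -1"
  shows "Complex x (\<sigma> * y) \<in> convex hull {0, complex_of_real (sin b / sin (a + b)) * cis (\<sigma> * a), 1}"
proof -
  have s: "0 < sin a" "0 < sin b" "0 < sin (a + b)" using ab by (auto intro!: sin_gt_zero)
  define p where "p = y * sin (a + b) / (sin a * sin b)"
  define q where "q = x - y * cos a / sin a"
  have p: "0 \<le> p" using y s unfolding p_def by simp
  have q: "0 \<le> q" using l s unfolding q_def by (simp add: field_simps)
  have "p + q = x + y * cos b / sin b"
    using s unfolding p_def q_def sin_add by (simp add: field_simps)
  moreover have "y * cos b / sin b \<le> 1 - x" using r s by (simp add: pos_divide_le_eq)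
  ultimately have pq: "0 \<le> 1 - p - q" by linarith
  have t: "p * (sin b / sin (a + b)) = y / sin a" using s unfolding p_def by simp
  have "Complex x (\<sigma> * y) = (1 - p - q) *\<^sub>R 0 + p *\<^sub>R (complex_of_real (sin b / sin (a + b)) * cis (\<sigma> * a)) + q *\<^sub>R 1"
  proof (rule complex_eqI)
    have "p * (sin b / sin (a + b)) * cos (\<sigma> * a) + q = x"
      unfolding t q_def using \<sigma> by auto
    then show "Re (Complex x (\<sigma> * y)) = Re ((1 - p - q) *\<^sub>R 0 + p *\<^sub>R (complex_of_real (sin b / sin (a + b)) * cis (\<sigma> * a)) + q *\<^sub>R 1)"
      by (simp add: mult.assoc)
    have "p * (sin b / sin (a + b)) * sin (\<sigma> * a) = \<sigma> * y"
      unfolding t using \<sigma> s by auto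
    then show "Im (Complex x (\<sigma> * y)) = Im ((1 - p - q) *\<^sub>R 0 + p *\<^sub>R (complex_of_real (sin b / sin (a + b)) * cis (\<sigma> * a)) + q *\<^sub>R 1)"
      by (simp add: mult.assoc)
  qed
  then show ?thesis unfolding convex_hull_3 using p q pq
    by (intro CollectI exI[of _ "1 - p - q"] exI[of _ p] exI[of _ q]) auto
qed

context near_rectangle
begin

text \<open>The signed distance from the line of side \<open>i\<close>. The minus sign makes it
  positive inside, as the vertices run clockwise.\<close>

definition height :: "nat \<Rightarrow> complex \<Rightarrow> real" where
  "height i z = - Im (cis (- \<theta> i) * (z - v i))"

lemma height_affine: "height i ((1 - t) *\<^sub>R x + t *\<^sub>R y) = (1 - t) * height i x + t * height i y"
proof -
  have "(1 - t) *\<^sub>R x + t *\<^sub>R y - v i = (1 - t) *\<^sub>R (x - v i) + t *\<^sub>R (y - v i)"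
    by (simp add: scaleR_conv_of_real algebra_simps)
  then show ?thesis unfolding height_def by (simp add: algebra_simps)
qed

lemma cos_e_pos: "0 < cos (e i)"
  using abs_cos_diff_le[of "e i" 0] small[of i] m m2 by simp

lemma len_pos: "0 < len i"
  using len(1)[of i] m by linarith

lemma height_vertex: "height i (v i) = 0" "height i (v (i + 1)) = 0"
  "0 < height i (v (i + 2))" "0 < height i (v (i + 3))"
proof -
  show "height i (v i) = 0" by (simp add: height_def)
  show "height i (v (i + 1)) = 0" by (simp add: height_def side cis_mult mult.left_commute)
  have "v (i + 2) - v i = complex_of_real (len i) * cis (\<theta> i) + complex_of_real (len (i + 1)) * cis (\<theta> (i + 1))"
    using side[of i] side[of "Suc i"] by simp
  then have "cis (- \<theta> i) * (v (i + 2) - v i) = complex_of_real (len i) * (cis (- \<theta> i) * cis (\<theta> i))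
      + complex_of_real (len (i + 1)) * (cis (- \<theta> i) * cis (\<theta> (i + 1)))"
    by (simp only: distrib_left mult.left_commute)
  then have "cis (- \<theta> i) * (v (i + 2) - v i) = complex_of_real (len i) + complex_of_real (len (i + 1)) * cis (\<theta> (i + 1) - \<theta> i)"
    by (simp add: cis_mult)
  moreover have "sin (\<theta> (i + 1) - \<theta> i) = - cos (e (i + 1))"
    using turn[of i] by (simp add: sin_diff)
  ultimately have "height i (v (i + 2)) = len (i + 1) * cos (e (i + 1))" unfolding height_def by simp
  then show "0 < height i (v (i + 2))" using len_pos cos_e_pos by simp
  have "v i = v (i + 3) + complex_of_real (len (i + 3)) * cis (\<theta> (i + 3))"
    using side[of "i + 3"] period(1)[of i] by (simp add: eval_nat_numeral)
  then have "cis (- \<theta> i) * (v (i + 3) - v i) = - (complex_of_real (len (i + 3)) * cis (\<theta> (i + 3) - \<theta> i))"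
    by (simp add: algebra_simps cis_mult)
  moreover have "\<theta> (i + 3) - \<theta> i = pi / 2 - e i - 2 * pi"
    using turn[of "i + 3"] period(2,3)[of i] by (simp add: eval_nat_numeral)
  moreover have "sin (pi / 2 - e i - 2 * pi) = cos (e i)"
    using sin_periodic[of "pi / 2 - e i - 2 * pi"] sin_cos_eq[of "pi / 2 - e i"]
    by (simp only: diff_add_cancel) simp
  ultimately have "height i (v (i + 3)) = len (i + 3) * cos (e i)" unfolding height_def by simp
  then show "0 < height i (v (i + 3))" using len_pos cos_e_pos by simp
qed

lemma height_side:
  assumes "s < 4" "i < 4" "p \<in> open_segment (v s) (v (Suc s))"
  shows "0 \<le> height i p" "s \<noteq> i \<Longrightarrow> 0 < height i p"
proof -
  obtain t where t: "0 < t" "t < 1" "p = (1 - t) *\<^sub>R v s + t *\<^sub>R v (Suc s)"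
    using assms(3) unfolding in_segment by blast
  have h: "height i p = (1 - t) * height i (v s) + t * height i (v (Suc s))"
    unfolding t(3) height_affine ..
  \<comment> \<open>Side \<open>s\<close> is the \<open>d\<close>-th one after side
    \<open>i\<close>; adding 4 keeps the subtraction of naturals exact.\<close>
  define d where "d = (s + 4 - i) mod 4"
  have id: "(i + d) mod 4 = s mod 4" unfolding d_def using assms(2) by (simp add: mod_add_right_eq)
  then have vs: "v s = v (i + d)" "v (Suc s) = v (Suc (i + d))"
    using v_mod[of s] v_mod[of "i + d"] by simp_all
  have "d < 4" unfolding d_def by simp
  then have "d = 0 \<or> d = 1 \<or> d = 2 \<or> d = 3" by linarith
  then show "0 \<le> height i p"
    using height_vertex[of i] period(1)[of i] t(1,2) unfolding h vs by (elim disjE) (auto simp: eval_nat_numeral)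
  assume "s \<noteq> i"
  then have "d \<noteq> 0" using id assms(1,2) by (intro notI) simp
  with \<open>d = 0 \<or> d = 1 \<or> d = 2 \<or> d = 3\<close> show "0 < height i p"
    using height_vertex[of i] period(1)[of i] t(1,2) unfolding h vs by (elim disjE) (auto simp: eval_nat_numeral intro: add_pos_pos)
qed

text \<open>Heights are affine, and as the ends lie on different sides, at least one of them is
  strictly above any given side. So the open chord lies in an open subset of
  \<open>Q\<close>.\<close>

lemma chord_subset_interior:
  assumes "s < 4" "s' < 4" "s \<noteq> s'" "p \<in> open_segment (v s) (v (Suc s))" "p' \<in> open_segment (v s') (v (Suc s'))"
    and sub: "{z. \<forall>i<4. 0 < height i z} \<subseteq> Q"
  shows "open_segment p p' \<subseteq> interior Q"
proof -
  have "{z. \<forall>i<4. 0 < height i z} = (\<Inter>i\<in>{..<4}. {z. 0 < height i z})" by auto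
  also have "open \<dots>" unfolding height_def
    by (intro open_INT ballI open_Collect_less continuous_intros) auto
  finally have "{z. \<forall>i<4. 0 < height i z} \<subseteq> interior Q" using sub by (rule interior_maximal[rotated])
  moreover have "z \<in> {z. \<forall>i<4. 0 < height i z}" if "z \<in> open_segment p p'" for z
  proof -
    obtain t where t: "0 < t" "t < 1" "z = (1 - t) *\<^sub>R p + t *\<^sub>R p'"
      using \<open>z \<in> _\<close> unfolding in_segment by blast
    have "0 < height i z" if i: "i < 4" for i
    proof (cases "s = i")
      case True
      then show ?thesis unfolding t(3) height_affine
        using height_side(1)[OF assms(1) i assms(4)] height_side(2)[OF assms(2) i assms(5)] assms(3) t
        by (intro add_nonneg_pos) auto
    next
      case False
      then show ?thesis unfolding t(3) height_affine
        using height_side(2)[OF assms(1) i assms(4)] height_side(1)[OF assms(2) i assms(5)] t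
        by (intro add_pos_nonneg) auto
    qed
    then show ?thesis by simp
  qed
  ultimately show ?thesis by blast
qed

end

section \<open>Parameters near the rectangle line\<close>

lemma triangle_apex:
  assumes "sin (a + b) \<noteq> 0"
  shows "complex_of_real (sin b / sin (a + b)) * cis a + complex_of_real (sin a / sin (a + b)) * cis (- b) = 1"
proof (rule complex_eqI)
  have "sin b / sin (a + b) * cos a + sin a / sin (a + b) * cos b = (sin a * cos b + cos a * sin b) / sin (a + b)"
    by (simp add: add_divide_distrib)
  also have "\<dots> = 1" using assms unfolding sin_add[symmetric] by simp
  finally show "Re (complex_of_real (sin b / sin (a + b)) * cis a + complex_of_real (sin a / sin (a + b)) * cis (- b)) = Re 1"
    by simp
qed simp

text \<open>The four sums are the interior angles or their supplements. The sines bound the side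
  lengths from below, and \<open>m\<^sup>2 / 2000\<close> is a twentieth of the bound
  \<open>m\<^sup>2 / 100\<close> for the kick orbits.\<close>

definition near_rectangles :: "real \<Rightarrow> quadparam set" where
  "near_rectangles m = {(a, b, c, d). m < sin a \<and> m < sin b \<and> m < sin c \<and> m < sin d
     \<and> \<bar>a + b - pi / 2\<bar> < m\<^sup>2 / 2000 \<and> \<bar>b + c - pi / 2\<bar> < m\<^sup>2 / 2000
     \<and> \<bar>c + d - pi / 2\<bar> < m\<^sup>2 / 2000 \<and> \<bar>d + a - pi / 2\<bar> < m\<^sup>2 / 2000}"

lemma open_near_rectangles: "open (near_rectangles m)"
proof -
  have "near_rectangles m = {q. m < sin (fst q)} \<inter> {q. m < sin (fst (snd q))}
     \<inter> {q. m < sin (fst (snd (snd q)))} \<inter> {q. m < sin (snd (snd (snd q)))}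
     \<inter> {q. \<bar>fst q + fst (snd q) - pi / 2\<bar> < m\<^sup>2 / 2000} \<inter> {q. \<bar>fst (snd q) + fst (snd (snd q)) - pi / 2\<bar> < m\<^sup>2 / 2000}
     \<inter> {q. \<bar>fst (snd (snd q)) + snd (snd (snd q)) - pi / 2\<bar> < m\<^sup>2 / 2000}
     \<inter> {q. \<bar>snd (snd (snd q)) + fst q - pi / 2\<bar> < m\<^sup>2 / 2000}"
    unfolding near_rectangles_def by auto
  also have "open \<dots>" by (intro open_Int open_Collect_less continuous_intros)
  finally show ?thesis .
qed

text \<open>The lengths come from the law of sines in the two triangles over the diagonal of length
  1. \<open>\<theta>\<close> loses \<open>2 * pi\<close> with each round, so that the turning rule
  also holds from side 3 to side 4.\<close>

lemma near_rectangles_vertices: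
  assumes q: "(a, b, c, d) \<in> near_rectangles m" and m: "0 < m" "m \<le> 1"
  defines "len \<equiv> \<lambda>i. [sin b / sin (a + b), sin a / sin (a + b), sin d / sin (c + d), sin c / sin (c + d)] ! (i mod 4)"
    and "\<theta> \<equiv> \<lambda>i. [a, - b, c - pi, - d - pi] ! (i mod 4) - 2 * pi * real (i div 4)"
    and "e \<equiv> \<lambda>i. [d + a - pi / 2, pi / 2 - a - b, b + c - pi / 2, pi / 2 - c - d] ! (i mod 4)"
  shows "near_rectangle (\<lambda>i. quad_vertex (a, b, c, d) (i mod 4)) len \<theta> e m"
proof -
  have nr: "m < sin a" "m < sin b" "m < sin c" "m < sin d" "\<bar>a + b - pi / 2\<bar> < m\<^sup>2 / 2000" "\<bar>b + c - pi / 2\<bar> < m\<^sup>2 / 2000"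
     "\<bar>c + d - pi / 2\<bar> < m\<^sup>2 / 2000" "\<bar>d + a - pi / 2\<bar> < m\<^sup>2 / 2000"
    using q by (auto simp: near_rectangles_def)
  have m2: "m\<^sup>2 \<le> 1" using m by (simp add: power2_eq_square mult_le_one)
  have s1: "1 / 2 \<le> sin (a + b)" "1 / 2 \<le> sin (c + d)"
    using abs_sin_diff_le[of "a + b" "pi / 2"] abs_sin_diff_le[of "c + d" "pi / 2"] nr(5,7) m2 by simp_all
  have bd: "m \<le> x / y \<and> x / y \<le> 2" if "m < x" "x \<le> 1" "1 / 2 \<le> y" "y \<le> 1" for x y :: real
  proof
    have "m * y \<le> m" using that m by (simp add: mult_left_le)
    then show "m \<le> x / y" using that by (simp add: field_simps)
    show "x / y \<le> 2" using that by (simp add: field_simps)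
  qed
  have mod: "i mod 4 = 0 \<or> i mod 4 = 1 \<or> i mod 4 = 2 \<or> i mod 4 = 3" for i :: nat by presburger
  have cs: "cis (x - 2 * pi * real n) = cis x" for x n
  proof (induction n)
    case (Suc n)
    have "x - 2 * pi * real (Suc n) = (x - 2 * pi * real n) - 2 * pi" by (simp add: algebra_simps)
    then show ?case using Suc by (simp only: cis_pi_shift)
  qed simp
  have ne: "sin (a + b) \<noteq> 0" "sin (c + d) \<noteq> 0" using s1 by auto
  show ?thesis
  proof
    fix i :: nat
    have c1: "cis (\<theta> i) = cis ([a, - b, c - pi, - d - pi] ! (i mod 4))" unfolding \<theta>_def cs ..
    have ab: "1 = complex_of_real (sin b / sin (a + b)) * cis a + complex_of_real (sin a / sin (a + b)) * cis (- b)"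
      using triangle_apex[OF ne(1)] by simp
    have "sin (d + c) \<noteq> 0" using ne(2) by (simp add: add.commute)
    from arg_cong[OF triangle_apex[OF this], of cnj] have cd: "complex_of_real (sin c / sin (c + d)) * cis (- d) = 1 + complex_of_real (sin d / sin (c + d)) * cis (c - pi)"
      unfolding cis_pi_shift by (simp add: cis_cnj add.commute algebra_simps)
    have da: "0 = complex_of_real (sin c / sin (c + d)) * cis (- d) + complex_of_real (sin c / sin (c + d)) * cis (- d - pi)"
      unfolding cis_pi_shift by simp
    show "quad_vertex (a, b, c, d) (Suc i mod 4) = quad_vertex (a, b, c, d) (i mod 4) + complex_of_real (len i) * cis (\<theta> i)"
      unfolding c1 len_def using mod[of i]
    proof (elim disjE)
      assume i: "i mod 4 = 0"
      then have "Suc i mod 4 = 1" by presburger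
      with i show "quad_vertex (a, b, c, d) (Suc i mod 4) = quad_vertex (a, b, c, d) (i mod 4)
        + complex_of_real ([sin b / sin (a + b), sin a / sin (a + b), sin d / sin (c + d), sin c / sin (c + d)] ! (i mod 4))
        * cis ([a, - b, c - pi, - d - pi] ! (i mod 4))" by simp
    next
      assume i: "i mod 4 = 1"
      then have "Suc i mod 4 = 2" by presburger
      with i ab show "quad_vertex (a, b, c, d) (Suc i mod 4) = quad_vertex (a, b, c, d) (i mod 4)
        + complex_of_real ([sin b / sin (a + b), sin a / sin (a + b), sin d / sin (c + d), sin c / sin (c + d)] ! (i mod 4))
        * cis ([a, - b, c - pi, - d - pi] ! (i mod 4))" by simp
    next
      assume i: "i mod 4 = 2"
      then have "Suc i mod 4 = 3" by presburger
      with i cd show "quad_vertex (a, b, c, d) (Suc i mod 4) = quad_vertex (a, b, c, d) (i mod 4)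
        + complex_of_real ([sin b / sin (a + b), sin a / sin (a + b), sin d / sin (c + d), sin c / sin (c + d)] ! (i mod 4))
        * cis ([a, - b, c - pi, - d - pi] ! (i mod 4))" by simp
    next
      assume i: "i mod 4 = 3"
      then have "Suc i mod 4 = 0" by presburger
      with i da show "quad_vertex (a, b, c, d) (Suc i mod 4) = quad_vertex (a, b, c, d) (i mod 4)
        + complex_of_real ([sin b / sin (a + b), sin a / sin (a + b), sin d / sin (c + d), sin c / sin (c + d)] ! (i mod 4))
        * cis ([a, - b, c - pi, - d - pi] ! (i mod 4))" by simp
    qed
    show "\<theta> (Suc i) = \<theta> i - pi / 2 + e (Suc i)"
    proof -
      have "Suc i div 4 = (if i mod 4 = 3 then Suc (i div 4) else i div 4)" by presburger
      then show ?thesis unfolding \<theta>_def e_def using mod[of i]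
        by (elim disjE) (auto simp: mod_Suc algebra_simps)
    qed
    show "quad_vertex (a, b, c, d) ((i + 4) mod 4) = quad_vertex (a, b, c, d) (i mod 4)" by simp
    show "\<theta> (i + 4) = \<theta> i - 2 * pi" unfolding \<theta>_def by (simp add: algebra_simps)
    show "e (i + 4) = e i" unfolding e_def by simp
    show "m \<le> len i" "len i \<le> 2" unfolding len_def using mod[of i]
      by (elim disjE; use bd nr(1-4) s1 in simp)+
    have "\<bar>pi / 2 - a - b\<bar> \<le> m\<^sup>2 / 2000" "\<bar>pi / 2 - c - d\<bar> \<le> m\<^sup>2 / 2000" using nr(5,7) by linarith+
    then show "\<bar>e i\<bar> \<le> m\<^sup>2 / 2000" unfolding e_def using mod[of i] nr(6,8)
      by (elim disjE) auto
  qed (use m in auto)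
qed

lemma near_rectangles_periodic:
  assumes q: "q \<in> quad_space" "q \<in> near_rectangles m" and m: "0 < m" "m \<le> 1"
  shows "\<exists>p s n. billiard_path q p s \<and> 0 < n \<and> n \<le> 32 \<and> (\<forall>k. p (k + n) = p k)"
proof -
  obtain a b c d where abcd: "q = (a, b, c, d)" by (cases q)
  define v where "v = (\<lambda>i. quad_vertex q (i mod 4))"
  have ang: "0 < a" "0 < b" "0 < c" "0 < d" "a + b < pi" "c + d < pi" using q(1) by (auto simp: quad_space_def abcd)
  interpret near_rectangle v "\<lambda>i. [sin b / sin (a + b), sin a / sin (a + b), sin d / sin (c + d), sin c / sin (c + d)] ! (i mod 4)"
    "\<lambda>i. [a, - b, c - pi, - d - pi] ! (i mod 4) - 2 * pi * real (i div 4)"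
    "\<lambda>i. [d + a - pi / 2, pi / 2 - a - b, b + c - pi / 2, pi / 2 - c - d] ! (i mod 4)" m
    unfolding v_def abcd by (rule near_rectangles_vertices[OF q(2)[unfolded abcd] m])
  have sub: "{z. \<forall>i<4. 0 < height i z} \<subseteq> quad_region q"
  proof
    fix z assume "z \<in> {z. \<forall>i<4. 0 < height i z}"
    then have h: "0 < height 0 z" "0 < height 1 z" "0 < height 2 z" "0 < height 3 z" by auto
    have h0: "Im z * cos a < Re z * sin a"
      using h(1)[unfolded height_def] by (simp add: v_def abcd algebra_simps)
    \<comment> \<open>The point \<open>v 2 = 1\<close> lies on the line of side 1 too and is a
      simpler base point than \<open>v 1\<close>; likewise \<open>v 4 = 0\<close> for side
      3.\<close>
    have "height 1 (v 2) = 0" using height_vertex(2)[of 1] by (simp add: numeral_2_eq_2)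
    then have "0 < height 1 z - height 1 (v 2)" using h(2) by simp
    then have h1: "Im z * cos b < (1 - Re z) * sin b"
      unfolding height_def by (simp add: v_def abcd algebra_simps)
    have h2: "- Im z * cos c < (1 - Re z) * sin c"
      using h(3)[unfolded height_def] by (simp add: v_def abcd algebra_simps cos_diff sin_diff)
    have "height 3 (v 4) = 0" using height_vertex(2)[of 3] by simp
    then have "0 < height 3 z - height 3 (v 4)" using h(4) by simp
    then have h3: "- Im z * cos d < Re z * sin d"
      unfolding height_def by (simp add: v_def abcd algebra_simps cos_diff sin_diff cos_add sin_add)
    show "z \<in> quad_region q"
    proof (cases "0 \<le> Im z")
      case True
      have "Complex (Re z) (1 * Im z) \<in> convex hull {0, complex_of_real (sin b / sin (a + b)) * cis (1 * a), 1}"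
        using in_convex_hull_triangle[OF ang(1,2,5) True, of "Re z" 1] h0 h1 by simp
      then show ?thesis unfolding quad_region_def abcd by (simp add: insert_commute)
    next
      case False
      have "Complex (Re z) (- 1 * - Im z) \<in> convex hull {0, complex_of_real (sin c / sin (d + c)) * cis (- 1 * d), 1}"
        using in_convex_hull_triangle[of d c "- Im z" "Re z" "- 1"] ang False h2 h3 by simp
      then show ?thesis unfolding quad_region_def abcd by (simp add: insert_commute add.commute)
    qed
  qed
  obtain S n where n: "0 < n" "n \<le> 32" "(S, S) \<in> bounce_link v ^^ n" using bounce_cycle by blast
  obtain f where f: "\<And>k. (f k, f (Suc k)) \<in> bounce_link v" "\<And>k. f (k + n) = f k"
    using cycle_function[OF n(3,1)] by blast
  define s where "s = (\<lambda>k. fst (f k))"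
  define p where "p = (\<lambda>k. fst (snd (f k)))"
  define u where "u = (\<lambda>k. snd (snd (f k)))"
  have fk: "f k = (s k, p k, u k)" for k by (simp add: s_def p_def u_def)
  have L: "s k < 4" "s k \<noteq> s (Suc k)" "p k \<in> open_segment (v (s k)) (v (Suc (s k)))"
      "\<exists>l>0. p (Suc k) - p k = complex_of_real l * u k"
      "u (Suc k) = reflect_dir (v (Suc (s (Suc k))) - v (s (Suc k))) (u k)" for k
    using f(1)[of k] unfolding fk bounce_link_def by auto
  have vs: "v (s k) = side_start q (s k)" "v (Suc (s k)) = side_end q (s k)" for k
    using L(1)[of k] by (simp_all add: v_def side_start_def side_end_def)
  have "billiard_path q p s"
    unfolding billiard_path_def
  proof (intro allI conjI)
    fix k
    show "s k < 4" by (rule L(1))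
    show "p k \<in> open_segment (side_start q (s k)) (side_end q (s k))" using L(3)[of k] by (simp only: vs)
    show int: "open_segment (p k) (p (Suc k)) \<subseteq> interior (quad_region q)"
      by (rule chord_subset_interior[OF L(1) L(1) L(2) L(3) L(3) sub])
    \<comment> \<open>The new point is strictly above the side that the old point lies on.\<close>
    show "p (Suc k) \<noteq> p k"
    proof
      assume eq: "p (Suc k) = p k"
      have "0 < height (s k) (p (Suc k))" using height_side(2)[OF L(1) L(1) L(3), of "Suc k" k] L(2)[of k] by metis
      moreover have "height (s k) (p k) = 0"
      proof -
        obtain t where t: "p k = (1 - t) *\<^sub>R v (s k) + t *\<^sub>R v (Suc (s k))"
          using L(3)[of k] unfolding in_segment by blast
        show ?thesis unfolding t height_affine using height_vertex(1,2)[of "s k"] by simp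
      qed
      ultimately show False using eq by simp
    qed
    obtain l where l: "0 < l" "p (Suc k) - p k = complex_of_real l * u k" using L(4) by blast
    obtain l' where l': "0 < l'" "p (Suc (Suc k)) - p (Suc k) = complex_of_real l' * u (Suc k)" using L(4) by blast
    \<comment> \<open>\<open>reflect_dir\<close> is real linear in the direction, so replacing
      \<open>u k\<close> by the chord only rescales by \<open>l\<close>.\<close>
    show "\<exists>l>0. p (Suc (Suc k)) - p (Suc k) = complex_of_real l *
        reflect_dir (side_end q (s (Suc k)) - side_start q (s (Suc k))) (p (Suc k) - p k)"
      using l l' L(5)[of k] unfolding vs
      by (intro exI[of _ "l' / l"]) (simp add: reflect_dir_def)
  qed
  moreover have "p (k + n) = p k" for k unfolding p_def f(2) ..
  ultimately show ?thesis using n by blast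
qed

text \<open>An orbit type is read off over the least period, which is at most \<open>n\<close>;
  squaring a word of odd length accounts for the factor 2.\<close>

lemma periodic_path_orbit_tile:
  assumes "q \<in> quad_space" "billiard_path q p s" "0 < n" "n \<le> N" "\<And>k. p (k + n) = p k"
  shows "q \<in> (\<Union>W\<in>{W. set W \<subseteq> {..<4} \<and> length W \<le> 2 * N}. orbit_tile W)"
proof -
  define P where "P = (\<lambda>j. 0 < j \<and> (\<forall>k. p (k + j) = p k))"
  have Pn: "P n" using assms by (simp add: P_def)
  define n0 where "n0 = (LEAST j. P j)"
  have 0: "P n0" "n0 \<le> n" using LeastI[of P, OF Pn] Least_le[of P, OF Pn] by (simp_all add: n0_def)
  have min: "\<not> (\<forall>k. p (k + j) = p k)" if "0 < j" "j < n0" for j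
    using not_less_Least[of j P] that by (auto simp: n0_def P_def)
  define W where "W = orbit_type_of_word (map s [0..<n0])"
  have "s k < 4" for k using assms(2) by (simp add: billiard_path_def)
  then have "set W \<subseteq> {..<4}" "length W \<le> 2 * N"
    using 0(2) assms(4) by (auto simp: W_def orbit_type_of_word_def)
  moreover have "has_periodic_path_of_type q W"
    unfolding has_periodic_path_of_type_def
    using assms(2) 0(1) min W_def unfolding P_def by (intro exI[of _ p] exI[of _ s] exI[of _ n0]) auto
  ultimately show ?thesis using assms(1) by (auto simp: orbit_tile_def)
qed

theorem theorem2p2p5:
  shows "\<exists>U. openin (top_of_set quad_space) U \<and> rectangle_line \<subseteq> U \<and>
             (\<exists>F. finite F \<and> U \<subseteq> (\<Union>W\<in>F. orbit_tile W))"
proof -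
  \<comment> \<open>The rectangle line contains arbitrarily thin rectangles, so no single
    \<open>m\<close> suffices. The union over \<open>m\<close> is harmless because the bound 32 on
    the period does not depend on \<open>m\<close>.\<close>
  define U where "U = quad_space \<inter> (\<Union>m\<in>{0<..1}. near_rectangles m)"
  have "openin (top_of_set quad_space) U"
    unfolding U_def by (rule openin_open_Int) (auto intro: open_near_rectangles)
  moreover have "rectangle_line \<subseteq> U"
  proof
    fix q assume "q \<in> rectangle_line"
    then obtain a b where q: "q = (a, b, a, b)" "q \<in> quad_space" "a + b = pi / 2"
      by (auto simp: rectangle_line_def)
    have "0 < a" "0 < b" using q(1,2) by (auto simp: quad_space_def)
    then have s: "0 < sin a" "0 < sin b" using q(3) by (auto intro!: sin_gt_zero)
    define m where "m = min (sin a) (sin b) / 2"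
    have m: "0 < m" "m < sin a" "m < sin b" using s by (auto simp: m_def min_def)
    then have "m \<le> 1" using sin_le_one[of a] by linarith
    have "a + b - pi / 2 = 0" "b + a - pi / 2 = 0" using q(3) by linarith+
    moreover have "0 < m\<^sup>2 / 2000" using m(1) by simp
    ultimately have "\<bar>a + b - pi / 2\<bar> < m\<^sup>2 / 2000" "\<bar>b + a - pi / 2\<bar> < m\<^sup>2 / 2000" by (simp_all only: abs_zero)
    then have "q \<in> near_rectangles m"
      unfolding near_rectangles_def q(1) mem_Collect_eq prod.case using m by blast
    then show "q \<in> U" using q(2) m(1) \<open>m \<le> 1\<close> by (auto simp: U_def)
  qed
  moreover have "U \<subseteq> (\<Union>W\<in>{W. set W \<subseteq> {..<4} \<and> length W \<le> 2 * 32}. orbit_tile W)"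
  proof
    fix q assume "q \<in> U"
    then obtain m where m: "0 < m" "m \<le> 1" "q \<in> near_rectangles m" and q: "q \<in> quad_space"
      by (auto simp: U_def)
    obtain p s n where *: "billiard_path q p s" "0 < n" "n \<le> 32" "\<forall>k. p (k + n) = p k"
      using near_rectangles_periodic[OF q m(3,1,2)] by blast
    show "q \<in> (\<Union>W\<in>{W. set W \<subseteq> {..<4} \<and> length W \<le> 2 * 32}. orbit_tile W)"
      by (rule periodic_path_orbit_tile[OF q *(1,2,3)]) (use *(4) in blast)
  qed
  moreover have "finite {W. set W \<subseteq> {..<4::nat} \<and> length W \<le> 2 * 32}"
    by (rule finite_lists_length_le) simp
  ultimately show ?thesis by blast
qed

end
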